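(* Let $M\subset\mathbb{C}^{n+d}$ ($n,d\ge1$) be a real analytic generic submanifold of codimension $d$ with $0\in M$, given in an open neighborhood $\Omega$ of $0$ in $\mathbb{C}^{n+d}$ by regular coordinates: $M\cap\Omega=\{(z,w)\in\Omega:\rho=0\}$ with $\rho:=\operatorname{Im}(w)-\phi(z,\overline z,\operatorname{Re}(w))$, $(z,w)\in\mathbb{C}^n\times\mathbb{C}^d$. Let $\Gamma\subset\mathbb{R}^d$ be an open convex cone with vertex at the origin, and let $f=u+iv$ ($u=\operatorname{Re}f$, $v=\operatorname{Im}f$) be a holomorphic function on the wedge $W=W(\Omega,\rho,\Gamma)$. Suppose that $f$ extends continuously up to the edge $M\cap\Omega$ (i.e. to a continuous function on $W\cup(M\cap\Omega)$) and that $v=\operatorname{Im}(f)$ is real analytic on the edge $M\cap\Omega$. Then there exist a neighborhood $\widetilde\Omega$ of $0$ in $\mathbb{C}^{n+d}$ and a holomorphic function $F$ on $\widetilde\Omega$ such that $F|_{W\cap\widetilde\Omega}=f|_{W\cap\widetilde\Omega}$.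
   Context: A real analytic real submanifold $M\subset\mathbb{C}^N$ of codimension $d$ is a set which near each of its points $p_0$ has the form $M\cap U=\{Z\in U:\rho(Z,\overline Z)=0\}$, with $U$ a neighborhood of $p_0$ and $\rho=(\rho_1,\dots,\rho_d)$ real analytic and $\mathbb{R}^d$-valued on $U$ with $d\rho_1,\dots,d\rho_d$ linearly independent in $U$. $M$ is generic if $\partial\rho_1,\dots,\partial\rho_d$ are $\mathbb{C}$-linearly independent at every $p\in M$. Regular coordinates: $M$ is given in a sufficiently small open neighborhood $\Omega$ of $0$ by $\operatorname{Im}(w)=\phi(z,\overline z,\operatorname{Re}(w))$ with $z\in\mathbb{C}^n$, $w\in\mathbb{C}^d$, where $\phi$ is an $\mathbb{R}^d$-valued real analytic function (convergent power series in $z,\overline z,\operatorname{Re}(w)$) with $\phi(0,0,0)=0$ and $d\phi(0,0,0)=0$. Wedge: for $\Gamma\subset\mathbb{R}^d$ an open convex cone with vertex at the origin, $W(\Omega,\rho,\Gamma):=\{Z\in\Omega:\rho(Z,\overline Z)\in\Gamma\}$, an open subset of $\mathbb{C}^{n+d}$ with edge $M\cap\Omega$. *)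

theory Defs
  imports "HOL-Analysis.Analysis"
begin

text \<open>The ambient space C^(n+d) is the product of C^n (variable z) and C^d (variable w).\<close>

type_synonym ('n, 'd) CC = "(complex ^ 'n) \<times> (complex ^ 'd)"

definition cscale :: "complex \<Rightarrow> ('n::finite, 'd::finite) CC \<Rightarrow> ('n, 'd) CC" where
  "cscale c Z = (c *s fst Z, c *s snd Z)"

definition vec_Re :: "complex ^ 'd \<Rightarrow> real ^ 'd" where
  "vec_Re w = (\<chi> j. Re (w $ j))"

definition vec_Im :: "complex ^ 'd \<Rightarrow> real ^ 'd" where
  "vec_Im w = (\<chi> j. Im (w $ j))"


text \<open>Holomorphy in several variables: complex differentiability, i.e. a Frechet derivative
  that is complex linear. As for the one-variable \<open>holomorphic_on\<close>, the set is meant to be open.\<close>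

definition holomorphic_CC_on ::
    "(('n::finite, 'd::finite) CC \<Rightarrow> complex) \<Rightarrow> ('n, 'd) CC set \<Rightarrow> bool" where
  "holomorphic_CC_on f S \<longleftrightarrow>
     (\<forall>Z\<in>S. \<exists>f'. (f has_derivative f') (at Z within S) \<and>
                 (\<forall>c V. f' (cscale c V) = c * f' V))"


text \<open>Real analyticity: near each point of the set, the function is the sum of an
  (unconditionally convergent) power series in the real coordinates. Multi-indices are the
  functions \<open>\<alpha>\<close> on the standard basis, normalised to vanish off it. The expansion holds on a full
  neighbourhood of each point of the set, so on an open set this is the usual notion.\<close>

definition real_analytic_on ::
    "('a::euclidean_space \<Rightarrow> 'b::real_normed_vector) \<Rightarrow> 'a set \<Rightarrow> bool" where
  "real_analytic_on g S \<longleftrightarrow>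
     (\<forall>a\<in>S. \<exists>r>0. \<exists>c :: ('a \<Rightarrow> nat) \<Rightarrow> 'b. \<forall>x\<in>ball a r.
        ((\<lambda>\<alpha>. (\<Prod>b\<in>Basis. ((x - a) \<bullet> b) ^ \<alpha> b) *\<^sub>R c \<alpha>) has_sum g x)
          {\<alpha>. \<forall>b. b \<notin> Basis \<longrightarrow> \<alpha> b = 0})"

text \<open>A function on a subset \<open>E\<close> (in the application, a locally closed real analytic submanifold)
  is real analytic if it is locally the restriction of a real analytic function on an open set
  of the ambient space.\<close>

definition real_analytic_along ::
    "('a::euclidean_space \<Rightarrow> 'b::real_normed_vector) \<Rightarrow> 'a set \<Rightarrow> bool" where
  "real_analytic_along g E \<longleftrightarrow>
     (\<forall>p\<in>E. \<exists>U G. open U \<and> p \<in> U \<and> real_analytic_on G U \<and> (\<forall>x\<in>E \<inter> U. G x = g x))"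


text \<open>The real differential of the \<open>j\<close>-th component of \<open>\<rho>\<close> at \<open>p\<close>, and its (1,0)-part
  \<open>\<partial>\<rho>\<^sub>j\<close>, the sum over all coordinates \<open>Z\<^sub>k\<close> of \<open>(\<partial>\<rho>\<^sub>j/\<partial>Z\<^sub>k) dZ\<^sub>k\<close>.\<close>

definition comp_d ::
    "(('n::finite, 'd::finite) CC \<Rightarrow> real ^ 'd) \<Rightarrow> 'd \<Rightarrow> ('n, 'd) CC \<Rightarrow> ('n, 'd) CC \<Rightarrow> real" where
  "comp_d \<rho> j p = frechet_derivative (\<lambda>Z. \<rho> Z $ j) (at p)"

definition comp_del ::
    "(('n::finite, 'd::finite) CC \<Rightarrow> real ^ 'd) \<Rightarrow> 'd \<Rightarrow> ('n, 'd) CC \<Rightarrow> ('n, 'd) CC \<Rightarrow> complex" where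
  "comp_del \<rho> j p V =
     (complex_of_real (comp_d \<rho> j p V) - \<i> * complex_of_real (comp_d \<rho> j p (cscale \<i> V))) / 2"

definition local_defining_function ::
    "('n::finite, 'd::finite) CC set \<Rightarrow> ('n, 'd) CC set \<Rightarrow> (('n, 'd) CC \<Rightarrow> real ^ 'd) \<Rightarrow> bool" where
  "local_defining_function M U \<rho> \<longleftrightarrow>
     open U \<and> real_analytic_on \<rho> U \<and> M \<inter> U = {Z\<in>U. \<rho> Z = 0} \<and>
     (\<forall>p\<in>U. \<forall>a :: 'd \<Rightarrow> real.
        (\<forall>V. (\<Sum>j\<in>UNIV. a j * comp_d \<rho> j p V) = 0) \<longrightarrow> (\<forall>j. a j = 0))"

text \<open>The codimension is \<open>d = CARD('d)\<close>, the number of components of the defining functions.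
  The linear independence of the \<open>\<partial>\<rho>\<^sub>j\<close> on \<open>M\<close> does not depend on the choice of \<open>\<rho>\<close>.\<close>

definition generic_real_analytic_submanifold :: "('n::finite, 'd::finite) CC set \<Rightarrow> bool" where
  "generic_real_analytic_submanifold M \<longleftrightarrow>
     (\<forall>p0\<in>M. \<exists>U \<rho>. p0 \<in> U \<and> local_defining_function M U \<rho> \<and>
        (\<forall>p\<in>M \<inter> U. \<forall>a :: 'd \<Rightarrow> complex.
           (\<forall>V. (\<Sum>j\<in>UNIV. a j * comp_del \<rho> j p V) = 0) \<longrightarrow> (\<forall>j. a j = 0)))"


text \<open>The function written \<open>\<phi>(z, cnj z, s)\<close> in the literature is a real analytic, in general not
  holomorphic, function of \<open>(z, s)\<close> in C^n x R^d; it is represented here as a function of that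
  pair. A power series in z, its conjugate and s is the same as one in Re z, Im z and s.\<close>

definition graph_defining_function ::
    "((complex ^ 'n) \<times> (real ^ 'd) \<Rightarrow> real ^ 'd) \<Rightarrow> ('n::finite, 'd::finite) CC \<Rightarrow> real ^ 'd" where
  "graph_defining_function \<phi> = (\<lambda>(z, w). vec_Im w - \<phi> (z, vec_Re w))"

definition regular_coordinates ::
    "('n::finite, 'd::finite) CC set \<Rightarrow> ('n, 'd) CC set
      \<Rightarrow> ((complex ^ 'n) \<times> (real ^ 'd) \<Rightarrow> real ^ 'd) \<Rightarrow> bool" where
  "regular_coordinates M \<Omega> \<phi> \<longleftrightarrow>
     open \<Omega> \<and> 0 \<in> \<Omega> \<and>
     real_analytic_on \<phi> ((\<lambda>(z, w). (z, vec_Re w)) ` \<Omega>) \<and>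
     \<phi> (0, 0) = 0 \<and> (\<phi> has_derivative (\<lambda>_. 0)) (at (0, 0)) \<and>
     M \<inter> \<Omega> = {Z\<in>\<Omega>. graph_defining_function \<phi> Z = 0}"


text \<open>The library predicate \<open>cone\<close> forces \<open>0\<close> into a nonempty cone, so the only open cones in that sense
  are the empty set and the whole space. Here only positive dilations are required.\<close>

definition open_convex_cone :: "'a::real_normed_vector set \<Rightarrow> bool" where
  "open_convex_cone \<Gamma> \<longleftrightarrow> open \<Gamma> \<and> convex \<Gamma> \<and> (\<forall>y\<in>\<Gamma>. \<forall>t>0. t *\<^sub>R y \<in> \<Gamma>)"

definition wedge ::
    "('n::finite, 'd::finite) CC set \<Rightarrow> (('n, 'd) CC \<Rightarrow> real ^ 'd) \<Rightarrow> (real ^ 'd) set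
      \<Rightarrow> ('n, 'd) CC set" where
  "wedge \<Omega> \<rho> \<Gamma> = {Z\<in>\<Omega>. \<rho> Z \<in> \<Gamma>}"

end

theory Submission imports Defs "HOL-Complex_Analysis.Complex_Analysis"
begin

text \<open>The theorem is reduced to the flat, totally real case, and there to a mean value formula.

The points of \<open>M\<close> with real \<open>z\<close> form a totally real submanifold of full dimension \<open>n + d\<close>. Let \<open>\<Phi>\<close>
be \<open>\<phi>\<close> with complex numbers put in place of the real variables \<open>x = Re z\<close> and \<open>s = Re w\<close>, at
\<open>Im z = 0\<close>. The holomorphic map \<open>(\<zeta>, \<sigma>) \<mapsto> (\<zeta>, \<sigma> + \<i>\<Phi>(\<zeta>, \<sigma>))\<close> takes the real points onto this slice,
and it is tangent to the identity at \<open>0\<close>, hence locally biholomorphic (\<open>holo_inverse_function\<close>). In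
these coordinates \<open>\<rho>\<close> differs from \<open>Im \<sigma>\<close> by an error that is small relative to the distance from
the real points (\<open>graph_slice_error\<close>), so \<open>W\<close> contains a flat wedge with a narrow cone around
\<open>(0, y0)\<close>, \<open>y0 \<in> \<Gamma>\<close>, and a linear change of variables turns this cone into one that contains an
orthant (\<open>cone_map\<close>).

Since \<open>Im f\<close> is real analytic on the slice, it continues to a holomorphic function \<open>V\<close> near \<open>0\<close>
(\<open>real_analytic_complexify\<close>). The function \<open>g = f - \<i>V\<close> on the flat wedge is continuous up to the
real points and real there. Schwarz reflection defines it on the opposite wedge too, and Rudin's
proof of the edge-of-the-wedge theorem gives the extension to a full neighbourhood as the mean value
of \<open>g\<close> over explicit circles in the two wedges (\<open>edge_of_the_wedge_reflection\<close>). That mean is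
holomorphic because holomorphy on complex lines, together with continuity, is holomorphy
(\<open>line_holo_imp_holo\<close>).

Adding \<open>\<i>V\<close> and returning to the original coordinates yields a holomorphic \<open>F\<close> near \<open>0\<close> that equals
\<open>f\<close> on an open subset of \<open>W\<close> close to \<open>0\<close>. Because \<open>\<Gamma>\<close> is convex, \<open>W\<close> meets suitable small
neighbourhoods of \<open>0\<close> in connected sets (\<open>wedge_neighbourhood\<close>), and the identity theorem
(\<open>holo_identity\<close>) gives \<open>F = f\<close> there.\<close>

section \<open>Complex-linear derivatives\<close>

text \<open>The complex structures are kept as parameters because several of them occur: multiplication by
\<open>\<i>\<close> on the plane, \<open>cscale \<i>\<close> on \<open>\<complex>\<^sup>n \<times> \<complex>\<^sup>d\<close>, and the formal one on the pairs \<open>X + \<i>Y\<close> of vectors of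
a real space. The chain rule is then a single statement.\<close>
definition holo_on :: "('a \<Rightarrow> 'a) \<Rightarrow> ('b \<Rightarrow> 'b)
    \<Rightarrow> ('a::real_normed_vector \<Rightarrow> 'b::real_normed_vector) \<Rightarrow> 'a set \<Rightarrow> bool" where
  "holo_on J K f S \<longleftrightarrow>
     (\<forall>Z\<in>S. \<exists>f'. (f has_derivative f') (at Z) \<and> (\<forall>V. f' (J V) = K (f' V)))"

lemma holo_on_compose:
  assumes "holo_on J K f S" "holo_on K L g T" "f ` S \<subseteq> T"
  shows "holo_on J L (\<lambda>x. g (f x)) S"
  unfolding holo_on_def
proof
  fix Z assume Z: "Z \<in> S"
  obtain f' where f': "(f has_derivative f') (at Z)" "\<And>V. f' (J V) = K (f' V)"
    using assms(1) Z by (auto simp: holo_on_def)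
  obtain g' where g': "(g has_derivative g') (at (f Z))" "\<And>V. g' (K V) = L (g' V)"
    using assms(2,3) Z unfolding holo_on_def by (metis image_subset_iff)
  have "((\<lambda>x. g (f x)) has_derivative (\<lambda>x. g' (f' x))) (at Z)"
    using diff_chain_at[OF f'(1) g'(1)] by (simp add: o_def)
  then show "\<exists>h'. ((\<lambda>x. g (f x)) has_derivative h') (at Z) \<and> (\<forall>V. h' (J V) = L (h' V))"
    using f'(2) g'(2) by (intro exI[of _ "\<lambda>x. g' (f' x)"]) simp
qed

lemma holo_on_subset: "holo_on J K f S \<Longrightarrow> T \<subseteq> S \<Longrightarrow> holo_on J K f T"
  by (auto simp: holo_on_def)

lemma holo_on_imp_continuous_on: "holo_on J K f S \<Longrightarrow> continuous_on S f"
  unfolding holo_on_def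
  by (intro continuous_at_imp_continuous_on) (meson has_derivative_continuous)

lemma holo_on_cong:
  assumes "open S" "\<And>x. x \<in> S \<Longrightarrow> f x = g x" "holo_on J K f S"
  shows "holo_on J K g S"
  unfolding holo_on_def
proof
  fix Z assume Z: "Z \<in> S"
  obtain f' where f': "(f has_derivative f') (at Z)" "\<forall>V. f' (J V) = K (f' V)"
    using assms(3) Z by (auto simp: holo_on_def)
  have "(g has_derivative f') (at Z)"
    using has_derivative_transform_within_open[OF f'(1) assms(1) Z] assms(2) by auto
  then show "\<exists>f'. (g has_derivative f') (at Z) \<and> (\<forall>V. f' (J V) = K (f' V))"
    using f'(2) by blast
qed

lemma holo_on_add_scaled:
  assumes "holo_on J ((*) \<i>) f S" "holo_on J ((*) \<i>) g S"
  shows "holo_on J ((*) \<i>) (\<lambda>x. f x + c * g x) S"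
  unfolding holo_on_def
proof
  fix Z assume Z: "Z \<in> S"
  obtain f' where f': "(f has_derivative f') (at Z)" "\<And>V. f' (J V) = \<i> * (f' V)"
    using assms(1) Z by (auto simp: holo_on_def)
  obtain g' where g': "(g has_derivative g') (at Z)" "\<And>V. g' (J V) = \<i> * (g' V)"
    using assms(2) Z by (auto simp: holo_on_def)
  have "((\<lambda>x. f x + c * g x) has_derivative (\<lambda>x. f' x + c * g' x)) (at Z)"
    by (intro has_derivative_add f' has_derivative_mult_right g')
  then show "\<exists>h'. ((\<lambda>x. f x + c * g x) has_derivative h') (at Z) \<and> (\<forall>V. h' (J V) = \<i> * (h' V))"
    using f'(2) g'(2) by (intro exI[of _ "\<lambda>x. f' x + c * g' x"]) (simp add: algebra_simps)
qed

lemma holo_on_holomorphic_on: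
  assumes "holo_on ((*) \<i>) ((*) \<i>) f S" 
  shows "f holomorphic_on S"
  unfolding holomorphic_on_def
proof
  fix z assume z: "z \<in> S"
  obtain f' where f': "(f has_derivative f') (at z)" "\<And>V. f' (\<i> * V) = \<i> * (f' V)"
    using assms(1) z by (auto simp: holo_on_def)
  interpret f': bounded_linear f' using f'(1) by (rule has_derivative_bounded_linear)
  have "f' V = f' 1 * V" for V
  proof -
    have "V = Re V *\<^sub>R 1 + Im V *\<^sub>R (\<i> * 1)" by (simp add: complex_eq_iff)
    then have "f' V = Re V *\<^sub>R f' 1 + Im V *\<^sub>R (\<i> * f' 1)"
      by (metis f'(2) f'.add f'.scaleR)
    then show ?thesis by (simp add: complex_eq_iff)
  qed
  then have "f' = (*) (f' 1)" by (rule ext)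
  then show "f field_differentiable at z within S"
    using f'(1) unfolding field_differentiable_def has_field_derivative_def
    by (intro exI[of _ "f' 1"]) (simp add: has_derivative_at_withinI)
qed

definition cmult :: "('a \<Rightarrow> 'a) \<Rightarrow> complex \<Rightarrow> 'a::real_vector \<Rightarrow> 'a" where
  "cmult J t V = Re t *\<^sub>R V + Im t *\<^sub>R J V"

text \<open>Taylor's formula with the Cauchy estimate \<open>2! M / (1/4)\<^sup>2 = 32 M\<close> for the second derivative on
\<open>cball 0 (1/2)\<close>. The bound depends on \<open>f\<close> only through \<open>M\<close>, so it can be used on all complex
lines through all points near a given one simultaneously.\<close>
lemma second_order_bound:
  assumes f: "f holomorphic_on ball 0 1" and M: "\<And>z. norm z < 1 \<Longrightarrow> norm (f z) \<le> M"
    and t: "norm t \<le> 1/2"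
  shows "norm (f t - f 0 - t * deriv f 0) \<le> 32 * M * (norm t)^2"
proof -
  let ?S = "cball (0::complex) (1/2)"
  have b2: "norm ((deriv ^^ 2) f x) \<le> 32 * M" if x: "x \<in> ?S" for x
  proof -
    have sub: "cball x (1/4) \<subseteq> ball 0 1"
      using x by (auto simp: cball_subset_ball_iff)
    have "norm ((deriv ^^ 2) f x) \<le> fact 2 * M / (1/4)^2"
    proof (rule Cauchy_inequality)
      show "f holomorphic_on ball x (1/4)"
        using f sub ball_subset_cball holomorphic_on_subset by blast
      show "continuous_on (cball x (1/4)) f"
        using f sub holomorphic_on_imp_continuous_on holomorphic_on_subset by blast
      show "norm (f y) \<le> M" if "norm (x - y) = 1/4" for y
        using M sub that by (auto simp: subset_iff dist_norm)
    qed auto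
    then show ?thesis by (simp add: power2_eq_square)
  qed
  have "norm ((deriv ^^ 0) f t - (\<Sum>i\<le>1. (deriv ^^ i) f 0 * (t - 0) ^ i / (fact i)))
          \<le> (32*M) * norm(t - 0)^(Suc 1) / fact 1"
  proof (rule field_Taylor[where S="?S" and f="\<lambda>i. (deriv ^^ i) f"])
    show "((deriv ^^ i) f has_field_derivative (deriv ^^ Suc i) f x) (at x within ?S)"
      if "x \<in> ?S" for i x
    proof -
      have "(deriv ^^ i) f holomorphic_on ball 0 1"
        using f holomorphic_higher_deriv by blast
      then show ?thesis using that
        by (auto intro!: holomorphic_derivI[where S="ball 0 1"])
    qed
    show "norm ((deriv ^^ Suc 1) f x) \<le> 32 * M" if "x \<in> ?S" for x
      using b2[OF that] by (simp add: numeral_2_eq_2)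
  qed (use t in auto)
  then show ?thesis by (simp add: algebra_simps power2_eq_square)
qed

section \<open>Functions holomorphic along complex lines\<close>
locale complex_structure =
  fixes J :: "'a::euclidean_space \<Rightarrow> 'a"
  assumes linear_J: "linear J" and J_J: "J (J V) = - V"
begin

lemma bounded_linear_J: "bounded_linear J"
  using linear_J by (simp add: linear_conv_bounded_linear)

lemma bounded_linear_cmult_left: "bounded_linear (\<lambda>t. cmult J t V)"
  unfolding cmult_def
  by (intro bounded_linear_add bounded_linear_compose[OF bounded_linear_scaleR_left]
      bounded_linear_Re bounded_linear_Im)

lemma cmult_i: "cmult J (\<i> * t) V = J (cmult J t V)"
  unfolding cmult_def
  using linear_J by (simp add: linear_add linear_scale J_J algebra_simps)

lemma cmult_cmult: "cmult J s (cmult J t V) = cmult J (s * t) V"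
  unfolding cmult_def
  using linear_J by (simp add: linear_add linear_scale J_J algebra_simps)

lemma cmult_simps [simp]:
  "cmult J 0 V = 0" "cmult J 1 V = V" "cmult J (complex_of_real a) V = a *\<^sub>R V"
  "cmult J \<i> V = J V" "cmult J t 0 = 0"
  using linear_J by (auto simp: cmult_def linear_0)

lemma norm_cmult_le: obtains C where "C > 0" "\<And>t V. norm (cmult J t V) \<le> C * norm t * norm V"
proof -
  obtain K where K: "K > 0" "\<And>V. norm (J V) \<le> norm V * K"
    using bounded_linear.pos_bounded[OF bounded_linear_J] by blast
  have "norm (cmult J t V) \<le> (1 + K) * norm t * norm V" for t V
  proof -
    have "norm (cmult J t V) \<le> \<bar>Re t\<bar> * norm V + \<bar>Im t\<bar> * norm (J V)"
      unfolding cmult_def by (metis norm_scaleR norm_triangle_ineq)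
    also have "\<dots> \<le> norm t * norm V + norm t * (norm V * K)"
      by (intro add_mono mult_mono K abs_Re_le_cmod abs_Im_le_cmod) auto
    finally show ?thesis by (simp add: algebra_simps)
  qed
  with K(1) show ?thesis by (intro that[of "1 + K"]) auto
qed

lemma holo_on_line: "holo_on ((*) \<i>) J (\<lambda>t. Z + cmult J t V) T"
  unfolding holo_on_def
proof (intro ballI exI conjI allI)
  show "((\<lambda>t. Z + cmult J t V) has_derivative (\<lambda>t. cmult J t V)) (at t0)" for t0
    using has_derivative_add[OF has_derivative_const
        bounded_linear_imp_has_derivative[OF bounded_linear_cmult_left]] by fastforce
qed (rule cmult_i)

lemma holomorphic_on_line:
  assumes "holo_on J ((*) \<i>) h S"
  shows "(\<lambda>t. h (Z + cmult J t V)) holomorphic_on {t. Z + cmult J t V \<in> S}"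
  by (rule holo_on_holomorphic_on) (rule holo_on_compose[OF holo_on_line assms], auto)

lemma open_line: "open S \<Longrightarrow> open {t. Z + cmult J t V \<in> S}"
  using open_vimage[of S "\<lambda>t. Z + cmult J t V"]
    continuous_on_add[OF continuous_on_const linear_continuous_on[OF bounded_linear_cmult_left]]
  by (simp add: vimage_def)

lemma convex_line:
  assumes "convex T" shows "convex {t. Z + cmult J t V \<in> T}"
  unfolding convex_def
proof (intro ballI allI impI)
  fix s t :: complex and u v :: real
  assume *: "s \<in> {t. Z + cmult J t V \<in> T}" "t \<in> {t. Z + cmult J t V \<in> T}"
    "0 \<le> u" "0 \<le> v" "u + v = 1"
  have Z: "Z = u *\<^sub>R Z + v *\<^sub>R Z" using *(5) by (metis scaleR_add_left scaleR_one)
  have "Z + cmult J (u *\<^sub>R s + v *\<^sub>R t) V = u *\<^sub>R (Z + cmult J s V) + v *\<^sub>R (Z + cmult J t V)"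
    by (subst Z) (simp add: cmult_def algebra_simps)
  then show "u *\<^sub>R s + v *\<^sub>R t \<in> {t. Z + cmult J t V \<in> T}"
    using * assms by (simp add: convex_def)
qed

text \<open>A criterion that passes to locally uniform limits and to integrals with a parameter, where the
one-variable theory applies line by line. By Osgood's lemma below it is equivalent to \<open>holo_on\<close>.\<close>
definition line_holo_on :: "('a \<Rightarrow> complex) \<Rightarrow> 'a set \<Rightarrow> bool" where
  "line_holo_on h S \<longleftrightarrow> continuous_on S h \<and>
     (\<forall>Z\<in>S. \<forall>V. (\<lambda>t. h (Z + cmult J t V)) field_differentiable at 0)"

lemma line_holo_on_holomorphic:
  assumes "line_holo_on h S" 
  shows "(\<lambda>t. h (Z + cmult J t V)) holomorphic_on {t. Z + cmult J t V \<in> S}"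
  unfolding holomorphic_on_def
proof
  fix t0 assume "t0 \<in> {t. Z + cmult J t V \<in> S}"
  then have "(\<lambda>t. h (Z + cmult J t0 V + cmult J t V)) field_differentiable at 0"
    using assms by (auto simp: line_holo_on_def)
  then have *: "(\<lambda>t. h (Z + cmult J t0 V + cmult J t V)) field_differentiable at (t0 - t0)"
    by simp
  have "(\<lambda>t. h (Z + cmult J t0 V + cmult J (t - t0) V)) field_differentiable at t0"
    using field_differentiable_compose[of "\<lambda>t. t - t0" t0, OF _ *]
    by (simp add: o_def field_differentiable_diff)
  moreover have "Z + cmult J t0 V + cmult J (t - t0) V = Z + cmult J t V" for t
    by (simp add: cmult_def algebra_simps)
  ultimately show "(\<lambda>t. h (Z + cmult J t V)) field_differentiable at t0 within {t. Z + cmult J t V \<in> S}"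
    by (simp add: field_differentiable_at_within)
qed

text \<open>The candidate for the derivative: in the line through \<open>Z\<close> with direction \<open>V\<close>, the complex
derivative at \<open>Z\<close>.\<close>
definition cdir :: "('a \<Rightarrow> complex) \<Rightarrow> 'a \<Rightarrow> 'a \<Rightarrow> complex" where
  "cdir h Z V = deriv (\<lambda>t. h (Z + cmult J t V)) 0"

text \<open>The one-variable bound becomes uniform by rescaling each direction \<open>V\<close> to a fixed length \<open>q\<close>, so
small that the unit disc of the complex line stays in a ball where \<open>h\<close> is bounded.\<close>
lemma line_holo_second_order:
  assumes h: "line_holo_on h S" and S: "open S" and Z: "Z \<in> S"
  obtains r M where "r > 0" "M > 0" "ball Z r \<subseteq> S"
    "\<And>Y V. norm (Y - Z) < r \<Longrightarrow> norm V < r \<Longrightarrow> norm (h (Y + V) - h Y - cdir h Y V) \<le> M * (norm V)^2"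
proof -
  obtain C where C: "C > 0" "\<And>t V. norm (cmult J t V) \<le> C * norm t * norm V"
    using norm_cmult_le by blast
  obtain R where R: "R > 0" "cball Z R \<subseteq> S" using S Z open_contains_cball by blast
  have "compact (h ` cball Z R)"
    using h R(2) by (auto simp: line_holo_on_def intro!: compact_continuous_image
        intro: continuous_on_subset)
  then have "bounded (h ` cball Z R)" by (rule compact_imp_bounded)
  then obtain B where B: "B > 0" "\<And>x. x \<in> cball Z R \<Longrightarrow> norm (h x) \<le> B"
    unfolding bounded_pos by blast
  define q where "q = R / (2 * C + 2)"
  have q: "q > 0" "C * q \<le> R / 2" "q \<le> R/2" 
  proof -
    show "q > 0" using R C by (simp add: q_def)
    have "q * (2 * C + 2) = R" using C by (simp add: q_def)
    then have "2 * (C * q) + 2 * q = R" by (simp add: algebra_simps)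
    moreover have "C * q > 0" using C \<open>q > 0\<close> by simp
    ultimately show "C * q \<le> R / 2" "q \<le> R/2" using \<open>q > 0\<close> by auto
  qed
  define r where "r = q / 2"
  have r: "r > 0" "r \<le> R / 2" using q by (auto simp: r_def)
  show ?thesis
  proof (rule that[of r "32 * B / q^2"])
    show "r > 0" "32 * B / q^2 > 0" using r B q by auto
    show "ball Z r \<subseteq> S" using r R by (auto simp: subset_iff)
    fix Y V :: "'a" assume Y: "norm (Y - Z) < r" and V: "norm V < r"
    show "norm (h (Y + V) - h Y - cdir h Y V) \<le> 32 * B / q^2 * (norm V)^2"
    proof (cases "V = 0")
      case True then show ?thesis by (simp add: cdir_def)
    next
      case False
      define U where "U = (q / norm V) *\<^sub>R V"
      define f where "f = (\<lambda>t. h (Y + cmult J t U))"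
      have nU: "norm U = q" using False q by (simp add: U_def)
      have in_ball: "Y + cmult J t U \<in> cball Z R" if "norm t < 1" for t
      proof -
        have "norm (cmult J t U) \<le> C * norm t * q" using C(2)[of t U] nU by simp
        also have "\<dots> \<le> C * 1 * q" using that C q by (intro mult_mono) auto
        finally have "norm (cmult J t U) \<le> R / 2" using q by simp
        then have "norm (Y + cmult J t U - Z) \<le> R / 2 + R / 2"
          using norm_triangle_ineq[of "Y - Z" "cmult J t U"] Y r by (simp add: algebra_simps)
        then show ?thesis by (simp add: dist_norm norm_minus_commute)
      qed
      have f: "f holomorphic_on ball 0 1"
        unfolding f_def
        by (rule holomorphic_on_subset[OF line_holo_on_holomorphic[OF h]]) (use in_ball R in auto)
      define \<tau> where "\<tau> = norm V / q"
      have \<tau>: "norm (complex_of_real \<tau>) \<le> 1/2" "\<tau> > 0"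
        using V q False by (auto simp: \<tau>_def r_def norm_divide field_simps)
      have VU: "V = \<tau> *\<^sub>R U" using False q by (simp add: U_def \<tau>_def)
      have *: "norm (f \<tau> - f 0 - \<tau> * deriv f 0) \<le> 32 * B * (norm (complex_of_real \<tau>))^2"
        using f B(2) in_ball \<tau>(1) by (intro second_order_bound) (auto simp: f_def)
      have fd: "f field_differentiable at 0"
        using f by (auto intro: holomorphic_on_imp_differentiable_at)
      have "cdir h Y V = deriv (\<lambda>t. f (\<tau> * t)) 0"
        unfolding cdir_def f_def VU
        by (simp add: cmult_def algebra_simps linear_scale[OF linear_J])
      also have "\<dots> = \<tau> * deriv f 0"
        using deriv_chain[of "\<lambda>t. \<tau> * t" 0 f] fd
        by (simp add: o_def field_differentiable_mult algebra_simps)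
      finally have "cdir h Y V = \<tau> * deriv f 0" .
      moreover have "h (Y + V) = f \<tau>" "h Y = f 0"
        by (simp_all add: f_def flip: VU)
      moreover have "(norm (complex_of_real \<tau>))^2 = (norm V)^2 / q^2"
        using q by (simp add: \<tau>_def norm_divide power_divide)
      ultimately show ?thesis using * by simp
    qed
  qed
qed


lemma cdir_cmult:
  assumes h: "line_holo_on h S" and Z: "Z \<in> S"
  shows "cdir h Z (cmult J c V) = c * cdir h Z V"
proof -
  define f where "f = (\<lambda>t. h (Z + cmult J t V))"
  have fd: "f field_differentiable at 0"
    using h Z by (simp add: line_holo_on_def f_def)
  have "cdir h Z (cmult J c V) = deriv (\<lambda>t. f (c * t)) 0"
    unfolding cdir_def f_def by (simp add: cmult_cmult mult.commute)
  also have "\<dots> = c * deriv f 0"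
    using deriv_chain[of "\<lambda>t. c * t" 0 f] fd
    by (simp add: o_def field_differentiable_mult algebra_simps)
  finally show ?thesis by (simp add: cdir_def f_def)
qed

lemma cdir_scaleR:
  assumes h: "line_holo_on h S" and Z: "Z \<in> S"
  shows "cdir h Z (a *\<^sub>R V) = a *\<^sub>R cdir h Z V"
  using cdir_cmult[OF assms, of "of_real a" V] by (simp add: scaleR_conv_of_real)

lemma cdir_bound:
  assumes h: "line_holo_on h S" and S: "open S" and Z: "Z \<in> S"
  obtains r M where "r > 0" "M > 0" "ball Z r \<subseteq> S"
    "\<And>Y s. norm (Y - Z) < r \<Longrightarrow> 0 < s \<Longrightarrow> s * norm V < r \<Longrightarrow>
        norm ((h (Y + s *\<^sub>R V) - h Y) /\<^sub>R s - cdir h Y V) \<le> M * s * (norm V)^2"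
proof -
  obtain r M where rM: "r > 0" "M > 0" "ball Z r \<subseteq> S"
    "\<And>Y V. norm (Y - Z) < r \<Longrightarrow> norm V < r \<Longrightarrow> norm (h (Y + V) - h Y - cdir h Y V) \<le> M * (norm V)^2"
    using line_holo_second_order[OF assms] by metis
  show ?thesis
  proof (rule that[OF rM(1-3)])
    fix Y and s :: real assume Y: "norm (Y - Z) < r" and s: "0 < s" "s * norm V < r"
    have YS: "Y \<in> S" using Y rM(3) by (auto simp: dist_norm norm_minus_commute)
    have 1: "norm (h (Y + s *\<^sub>R V) - h Y - s *\<^sub>R cdir h Y V) \<le> M * (s * norm V)^2"
      using rM(4)[OF Y, of "s *\<^sub>R V"] s cdir_scaleR[OF h YS, of s V] by simp
    have "norm ((h (Y + s *\<^sub>R V) - h Y) /\<^sub>R s - cdir h Y V)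
        = norm ((h (Y + s *\<^sub>R V) - h Y - s *\<^sub>R cdir h Y V) /\<^sub>R s)"
      using s by (simp add: scaleR_diff_right)
    also have "\<dots> = norm (h (Y + s *\<^sub>R V) - h Y - s *\<^sub>R cdir h Y V) / s"
      using s by (simp add: divide_inverse mult.commute)
    also have "\<dots> \<le> M * (s * norm V)^2 / s"
      using 1 s by (intro divide_right_mono) auto
    finally show "norm ((h (Y + s *\<^sub>R V) - h Y) /\<^sub>R s - cdir h Y V) \<le> M * s * (norm V)^2"
      using s by (simp add: power2_eq_square mult.assoc mult.left_commute)
  qed
qed

text \<open>Directional derivatives are locally uniform limits of difference quotients, which are continuous
in the base point.\<close>
lemma isCont_cdir:
  assumes h: "line_holo_on h S" and S: "open S" and Z: "Z \<in> S"
  shows "isCont (\<lambda>Y. cdir h Y V) Z"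
  unfolding isCont_def tendsto_iff
proof (intro allI impI)
  fix e :: real assume e: "e > 0"
  obtain r M where rM: "r > 0" "M > 0" "ball Z r \<subseteq> S"
    "\<And>Y s. norm (Y - Z) < r \<Longrightarrow> 0 < s \<Longrightarrow> s * norm V < r \<Longrightarrow>
        norm ((h (Y + s *\<^sub>R V) - h Y) /\<^sub>R s - cdir h Y V) \<le> M * s * (norm V)^2"
    by (rule cdir_bound[OF assms, of V]) blast
  have "((\<lambda>s. s * norm V) \<longlongrightarrow> 0 * norm V) (at_right 0)"
    by (intro tendsto_intros)
  then have 1: "\<forall>\<^sub>F s in at_right 0. s * norm V < r"
    using rM(1) by (simp add: order_tendstoD)
  have "((\<lambda>s. M * s * (norm V)^2) \<longlongrightarrow> M * 0 * (norm V)^2) (at_right 0)"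
    by (intro tendsto_intros)
  then have 2: "\<forall>\<^sub>F s in at_right 0. M * s * (norm V)^2 < e/3"
    by (rule order_tendstoD(2)) (use e in simp)
  have "\<forall>\<^sub>F s::real in at_right 0. s > 0" by (simp add: eventually_at_right_less)
  then have "\<forall>\<^sub>F s in at_right 0. s * norm V < r \<and> M * s * (norm V)^2 < e/3 \<and> s > 0"
    using 1 2 by eventually_elim auto
  then obtain s where s: "s * norm V < r" "M * s * (norm V)^2 < e/3" "s > 0"
    by (metis (no_types, lifting) eventually_happens trivial_limit_at_right_real)
  define g where "g = (\<lambda>Y. (h (Y + s *\<^sub>R V) - h Y) /\<^sub>R s)"
  have hc: "isCont h Y" if "Y \<in> S" for Y
    using h S that by (simp add: line_holo_on_def continuous_on_eq_continuous_at)
  have "isCont g Z"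
  proof -
    have "Z + s *\<^sub>R V \<in> ball Z r" using s by (simp add: dist_norm)
    then have hV: "isCont h (Z + s *\<^sub>R V)" using hc rM(3) by blast
    have "isCont (\<lambda>Y. h (Y + s *\<^sub>R V)) Z"
      unfolding isCont_def by (rule isCont_tendsto_compose[OF hV]) (intro tendsto_intros)
    then show ?thesis unfolding g_def
      by (rule continuous_scaleR[OF continuous_const continuous_diff]) (rule hc[OF Z])
  qed
  then have "\<forall>\<^sub>F Y in at Z. dist (g Y) (g Z) < e/3"
    using e tendstoD[of g "g Z" "at Z" "e/3"] unfolding isCont_def by simp
  moreover have "\<forall>\<^sub>F Y in at Z. dist Y Z < r"
    using rM(1) by (auto simp: eventually_at)
  ultimately show "\<forall>\<^sub>F Y in at Z. dist (cdir h Y V) (cdir h Z V) < e"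
  proof eventually_elim
    case (elim Y)
    have "norm (g Y - cdir h Y V) < e/3" "norm (g Z - cdir h Z V) < e/3"
      using rM(4)[of Y s] rM(4)[of Z s] elim s rM(1) by (auto simp: g_def dist_norm)
    moreover have "norm (cdir h Y V - cdir h Z V) \<le>
       norm (g Y - cdir h Y V) + norm (g Y - g Z) + norm (g Z - cdir h Z V)"
      using norm_triangle_ineq4[of "g Y - g Z + (g Z - cdir h Z V)" "g Y - cdir h Y V"]
        norm_triangle_ineq[of "g Y - g Z" "g Z - cdir h Z V"] by simp
    ultimately show ?case using elim by (auto simp: dist_norm)
  qed
qed

text \<open>The increment along \<open>V + W\<close> is an increment along \<open>V\<close> followed by one along \<open>W\<close> from a moving base
point; additivity therefore rests on the continuity of the directional derivative.\<close>
lemma cdir_add: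
  assumes h: "line_holo_on h S" and S: "open S" and Z: "Z \<in> S"
  shows "cdir h Z (V + W) = cdir h Z V + cdir h Z W"
proof -
  have null: "((\<lambda>s. M * s * (norm V)^2) \<longlongrightarrow> 0) (at_right 0)" for M and V :: 'a
  proof -
    have "((\<lambda>s. M * s * (norm V)^2) \<longlongrightarrow> M * 0 * (norm V)^2) (at_right 0)"
      by (intro tendsto_intros)
    then show ?thesis by simp
  qed
  have small: "\<forall>\<^sub>F s in at_right 0. 0 < s \<and> s * norm V < r" if "r > 0" for r and V :: 'a
  proof -
    have "((\<lambda>s. s * norm V) \<longlongrightarrow> 0 * norm V) (at_right 0)"
      by (intro tendsto_intros)
    then have "\<forall>\<^sub>F s in at_right 0. s * norm V < r"
      using that by (simp add: order_tendstoD)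
    moreover have "\<forall>\<^sub>F s::real in at_right 0. s > 0" by (simp add: eventually_at_right_less)
    ultimately show ?thesis by eventually_elim auto
  qed
  have lim: "((\<lambda>s. (h (Z + s *\<^sub>R V) - h Z) /\<^sub>R s) \<longlongrightarrow> cdir h Z V) (at_right 0)" for V
  proof -
    obtain r M where rM: "r > 0" "M > 0" "ball Z r \<subseteq> S"
      "\<And>Y s. norm (Y - Z) < r \<Longrightarrow> 0 < s \<Longrightarrow> s * norm V < r \<Longrightarrow>
          norm ((h (Y + s *\<^sub>R V) - h Y) /\<^sub>R s - cdir h Y V) \<le> M * s * (norm V)^2"
      by (rule cdir_bound[OF assms, of V]) blast
    have "((\<lambda>s. (h (Z + s *\<^sub>R V) - h Z) /\<^sub>R s - cdir h Z V) \<longlongrightarrow> 0) (at_right 0)"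
    proof (rule Lim_null_comparison[OF _ null[of M V]])
      show "\<forall>\<^sub>F s in at_right 0. norm ((h (Z + s *\<^sub>R V) - h Z) /\<^sub>R s - cdir h Z V) \<le> M * s * (norm V)^2"
        using small[OF rM(1), of V] by eventually_elim (use rM in auto)
    qed
    then show ?thesis by (simp add: LIM_zero_iff)
  qed
  have lim2: "((\<lambda>s. (h (Z + s *\<^sub>R V + s *\<^sub>R W) - h (Z + s *\<^sub>R V)) /\<^sub>R s) \<longlongrightarrow> cdir h Z W) (at_right 0)"
  proof -
    obtain r M where rM: "r > 0" "M > 0" "ball Z r \<subseteq> S"
      "\<And>Y s. norm (Y - Z) < r \<Longrightarrow> 0 < s \<Longrightarrow> s * norm W < r \<Longrightarrow>
          norm ((h (Y + s *\<^sub>R W) - h Y) /\<^sub>R s - cdir h Y W) \<le> M * s * (norm W)^2"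
      by (rule cdir_bound[OF assms, of W]) blast
    have 1: "((\<lambda>s. (h (Z + s *\<^sub>R V + s *\<^sub>R W) - h (Z + s *\<^sub>R V)) /\<^sub>R s
         - cdir h (Z + s *\<^sub>R V) W) \<longlongrightarrow> 0) (at_right 0)"
    proof (rule Lim_null_comparison[OF _ null[of M W]])
      show "\<forall>\<^sub>F s in at_right 0. norm ((h (Z + s *\<^sub>R V + s *\<^sub>R W) - h (Z + s *\<^sub>R V)) /\<^sub>R s
         - cdir h (Z + s *\<^sub>R V) W) \<le> M * s * (norm W)^2"
        using small[OF rM(1), of V] small[OF rM(1), of W] by eventually_elim (use rM in auto)
    qed
    have "((\<lambda>s. Z + s *\<^sub>R V) \<longlongrightarrow> Z + 0 *\<^sub>R V) (at_right 0)"
      by (intro tendsto_intros)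
    then have 2: "((\<lambda>s. cdir h (Z + s *\<^sub>R V) W) \<longlongrightarrow> cdir h Z W) (at_right 0)"
      using isCont_tendsto_compose[OF isCont_cdir[OF assms, of W]] by simp
    show ?thesis using tendsto_add[OF 1 2] by simp
  qed
  have "(\<lambda>s. (h (Z + s *\<^sub>R V + s *\<^sub>R W) - h (Z + s *\<^sub>R V)) /\<^sub>R s + (h (Z + s *\<^sub>R V) - h Z) /\<^sub>R s)
      = (\<lambda>s. (h (Z + s *\<^sub>R (V + W)) - h Z) /\<^sub>R s)"
    by (simp add: scaleR_add_right add.assoc flip: scaleR_add_right)
  then have "((\<lambda>s. (h (Z + s *\<^sub>R (V + W)) - h Z) /\<^sub>R s) \<longlongrightarrow> cdir h Z W + cdir h Z V) (at_right 0)"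
    using tendsto_add[OF lim2 lim[of V]] by simp
  with lim[of "V + W"] show ?thesis
    using tendsto_unique[OF trivial_limit_at_right_real] by (metis add.commute)
qed

text \<open>Osgood's lemma: additivity makes \<open>cdir h Z\<close> linear, and the second-order bound is uniform in the
direction, so it is the Frechet derivative.\<close>
lemma line_holo_has_derivative:
  assumes h: "line_holo_on h S" and S: "open S" and Z: "Z \<in> S"
  shows "(h has_derivative cdir h Z) (at Z)"
proof -
  obtain r M where rM: "r > 0" "M > 0" "ball Z r \<subseteq> S"
    "\<And>Y V. norm (Y - Z) < r \<Longrightarrow> norm V < r \<Longrightarrow> norm (h (Y + V) - h Y - cdir h Y V) \<le> M * (norm V)^2"
    using line_holo_second_order[OF assms] by metis
  have "linear (cdir h Z)"
    by (rule linearI) (use assms cdir_add cdir_scaleR in auto)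
  then have bl: "bounded_linear (cdir h Z)" by (simp add: linear_conv_bounded_linear)
  show ?thesis
    unfolding has_derivative_at
  proof (intro conjI bl)
    have null: "((\<lambda>V. M * norm V) \<longlongrightarrow> 0) (at (0::'a))"
      by (rule tendsto_eq_intros | simp)+
    show "(\<lambda>V. norm (h (Z + V) - h Z - cdir h Z V) / norm V) \<midarrow>0\<rightarrow> 0"
    proof (rule Lim_null_comparison[OF _ null])
      have "\<forall>\<^sub>F V in at (0::'a). norm V < r"
        using rM(1) by (auto simp: eventually_at intro!: exI[of _ r])
      then show "\<forall>\<^sub>F V in at 0. norm (norm (h (Z + V) - h Z - cdir h Z V) / norm V) \<le> M * norm V"
      proof eventually_elim
        case (elim V)
        then show ?case using rM(4)[of Z V] rM(1)
          by (cases "V = 0") (auto simp: field_simps power2_eq_square)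
      qed
    qed
  qed
qed

lemma cdir_J:
  assumes h: "line_holo_on h S" and Z: "Z \<in> S"
  shows "cdir h Z (J V) = \<i> * cdir h Z V"
  using cdir_cmult[OF assms, of \<i> V] by simp

lemma line_holo_imp_holo:
  assumes "line_holo_on h S" "open S"
  shows "holo_on J ((*) \<i>) h S"
  unfolding holo_on_def using line_holo_has_derivative[OF assms] cdir_J[OF assms(1)] by blast

lemma holo_imp_line_holo:
  assumes h: "holo_on J ((*) \<i>) h S" and S: "open S"
  shows "line_holo_on h S"
  unfolding line_holo_on_def
proof (intro conjI ballI allI)
  show "continuous_on S h" using h by (rule holo_on_imp_continuous_on)
  fix Z V assume "Z \<in> S"
  then show "(\<lambda>t. h (Z + cmult J t V)) field_differentiable at 0"
    by (intro holomorphic_on_imp_differentiable_at[OF holomorphic_on_line[OF h] open_line[OF S]]) simp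
qed

text \<open>Holomorphic functions are continuously differentiable, so near a critical point the norm of the
derivative is small.\<close>
lemma holo_small_lipschitz:
  assumes h: "holo_on J ((*) \<i>) h S" and S: "open S" and Z: "Z \<in> S"
    and der: "(h has_derivative (\<lambda>_. 0)) (at Z)" and e: "e > 0"
  obtains r where "r > 0" "ball Z r \<subseteq> S"
    "\<And>x y. x \<in> ball Z r \<Longrightarrow> y \<in> ball Z r \<Longrightarrow> norm (h x - h y) \<le> e * norm (x - y)"
proof -
  note lh = holo_imp_line_holo[OF h S]
  define N where "N = (\<lambda>Y. \<Sum>b\<in>Basis. norm (cdir h Y b))"
  have onorm: "onorm (cdir h Y) \<le> N Y" if Y: "Y \<in> S" for Y
  proof (rule onorm_bound)
    show "0 \<le> N Y" by (simp add: N_def sum_nonneg)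
    fix x :: 'a
    have lin: "linear (cdir h Y)"
      using line_holo_has_derivative[OF lh S Y] by (rule has_derivative_linear)
    have "norm (cdir h Y x) = norm (\<Sum>b\<in>Basis. (x \<bullet> b) *\<^sub>R cdir h Y b)"
    proof -
      have "cdir h Y (\<Sum>b\<in>Basis. (x \<bullet> b) *\<^sub>R b) = (\<Sum>b\<in>Basis. (x \<bullet> b) *\<^sub>R cdir h Y b)"
        by (simp only: linear_sum[OF lin] linear_scale[OF lin])
      then show ?thesis by (simp only: euclidean_representation)
    qed
    also have "\<dots> \<le> (\<Sum>b\<in>Basis. norm x * norm (cdir h Y b))"
      by (intro sum_norm_le) (auto intro!: mult_right_mono Basis_le_norm)
    finally show "norm (cdir h Y x) \<le> N Y * norm x"
      by (simp add: N_def sum_distrib_left mult.commute)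
  qed
  have "cdir h Z = (\<lambda>_. 0)"
    using has_derivative_unique[OF line_holo_has_derivative[OF lh S Z] der] .
  then have "N Z = 0" by (simp add: N_def)
  moreover have "isCont N Z"
    unfolding N_def by (intro continuous_intros isCont_cdir[OF lh S Z])
  ultimately have "(N \<longlongrightarrow> 0) (at Z)" by (simp add: isCont_def)
  then have "\<forall>\<^sub>F Y in at Z. N Y < e" using e by (simp add: order_tendstoD)
  moreover have "\<forall>\<^sub>F Y in at Z. Y \<in> S" using S Z by (rule eventually_at_in_open')
  ultimately have "\<forall>\<^sub>F Y in at Z. N Y < e \<and> Y \<in> S" by eventually_elim auto
  then obtain r where r: "r > 0" "\<And>Y. Y \<noteq> Z \<Longrightarrow> dist Y Z < r \<Longrightarrow> N Y < e \<and> Y \<in> S"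
    by (auto simp: eventually_at)
  have r': "N Y < e \<and> Y \<in> S" if "Y \<in> ball Z r" for Y
    using that r(2)[of Y] Z e \<open>N Z = 0\<close> by (cases "Y = Z") (auto simp: dist_commute)
  show ?thesis
  proof (rule that[OF r(1)])
    show "ball Z r \<subseteq> S" using r' by blast
    show "norm (h x - h y) \<le> e * norm (x - y)" if "x \<in> ball Z r" "y \<in> ball Z r" for x y
    proof (rule differentiable_bound[of "ball Z r" h "cdir h"])
      show "(h has_derivative cdir h x) (at x within ball Z r)" if "x \<in> ball Z r" for x
        using line_holo_has_derivative[OF lh S, of x] r'[OF that] by (simp add: has_derivative_at_withinI)
      show "onorm (cdir h x) \<le> e" if "x \<in> ball Z r" for x
        using onorm[of x] r'[OF that] by linarith
    qed (use that in auto)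
  qed
qed

text \<open>The complex line through a point of \<open>U\<close> and \<open>y\<close> meets the convex set \<open>T\<close> in a connected open set,
on which the one-variable identity theorem applies.\<close>
lemma holo_eq_0_ball:
  assumes h: "holo_on J ((*) \<i>) h S" and T: "convex T" "open T" "T \<subseteq> S"
    and U: "open U" "U \<noteq> {}" "U \<subseteq> T" "\<And>x. x \<in> U \<Longrightarrow> h x = 0" and y: "y \<in> T"
  shows "h y = 0"
proof -
  obtain x where x: "x \<in> U" using U by blast
  define f where "f = (\<lambda>t. h (x + cmult J t (y - x)))"
  let ?A = "{t. x + cmult J t (y - x) \<in> T}"
  have "f 1 = 0"
  proof (rule analytic_continuation_open[of "{t. x + cmult J t (y - x) \<in> U}" ?A f "\<lambda>_. 0"])
    show "open {t. x + cmult J t (y - x) \<in> U}" "open ?A" using open_line U T by auto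
    have "0 \<in> {t. x + cmult J t (y - x) \<in> U}" using x by simp
    then show "{t. x + cmult J t (y - x) \<in> U} \<noteq> {}" by blast
    show "connected ?A" by (intro convex_connected convex_line T)
    show "f holomorphic_on ?A"
      unfolding f_def by (rule holomorphic_on_line[OF holo_on_subset[OF h T(3)]])
  qed (use U y in \<open>auto simp: f_def\<close>)
  then show ?thesis by (simp add: f_def)
qed

text \<open>The points near which the difference vanishes identically form an open set, and a relatively
closed one by the convex case applied to balls.\<close>
lemma holo_identity:
  assumes f: "holo_on J ((*) \<i>) f S" and g: "holo_on J ((*) \<i>) g S"
    and S: "open S" "connected S"
    and U: "open U" "U \<noteq> {}" "U \<subseteq> S" "\<And>x. x \<in> U \<Longrightarrow> f x = g x" and y: "y \<in> S"
  shows "f y = g y"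
proof -
  define h where "h = (\<lambda>x. f x + (-1) * g x)"
  have h: "holo_on J ((*) \<i>) h S" unfolding h_def by (rule holo_on_add_scaled[OF f g])
  define A where "A = {x \<in> S. \<exists>V. open V \<and> x \<in> V \<and> V \<subseteq> S \<and> (\<forall>z\<in>V. h z = 0)}"
  have "open A"
    unfolding A_def by (subst open_subopen) blast
  have "open (S - A)"
  proof (subst open_subopen, intro ballI)
    fix x assume x: "x \<in> S - A"
    then obtain r where r: "r > 0" "ball x r \<subseteq> S" using S(1) open_contains_ball by blast
    have "ball x r \<inter> A = {}"
    proof (rule ccontr)
      assume "ball x r \<inter> A \<noteq> {}"
      then obtain z V where z: "z \<in> ball x r" "open V" "z \<in> V" "\<forall>z\<in>V. h z = 0"
        by (auto simp: A_def)
      have "h w = 0" if "w \<in> ball x r" for w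
        by (rule holo_eq_0_ball[OF h _ _ r(2), of "V \<inter> ball x r"]) (use z that in auto)
      then have "x \<in> A" using r unfolding A_def by (auto intro!: exI[of _ "ball x r"])
      then show False using x by blast
    qed
    then show "\<exists>T. open T \<and> x \<in> T \<and> T \<subseteq> S - A"
      using r by (intro exI[of _ "ball x r"]) auto
  qed
  moreover have "A \<inter> S \<noteq> {}"
  proof -
    obtain x where "x \<in> U" using U by blast
    then have "x \<in> A" using U by (auto simp: A_def h_def intro!: exI[of _ U])
    then show ?thesis by (auto simp: A_def)
  qed
  ultimately have "(S - A) \<inter> S = {}"
    using connectedD[OF S(2) \<open>open A\<close>, of "S - A"] by blast
  then have "S \<subseteq> A" by blast
  then show ?thesis using y by (auto simp: A_def h_def)
qed

end

section \<open>Complexification of a real Euclidean space\<close>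

text \<open>The pair \<open>(X, Y)\<close> stands for \<open>X + \<i>Y\<close>.\<close>
definition Jc :: "'a::euclidean_space \<times> 'a \<Rightarrow> 'a \<times> 'a" where
  "Jc Z = (- snd Z, fst Z)"

lemma complex_structure_Jc: "complex_structure Jc"
  by unfold_locales (auto simp: Jc_def intro!: linearI)

interpretation Jc: complex_structure Jc
  by (rule complex_structure_Jc)

definition ccoord :: "'a::euclidean_space \<times> 'a \<Rightarrow> 'a \<Rightarrow> complex" where
  "ccoord Z b = Complex (fst Z \<bullet> b) (snd Z \<bullet> b)"

definition cvec :: "('a::euclidean_space \<Rightarrow> complex) \<Rightarrow> 'a \<times> 'a" where
  "cvec p = ((\<Sum>b\<in>Basis. Re (p b) *\<^sub>R b), (\<Sum>b\<in>Basis. Im (p b) *\<^sub>R b))"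

lemma ccoord_cvec [simp]: "b \<in> Basis \<Longrightarrow> ccoord (cvec p) b = p b"
  by (simp add: ccoord_def cvec_def inner_sum_left inner_Basis if_distrib cong: if_cong)

lemma cvec_ccoord [simp]: "cvec (ccoord Z) = Z"
  by (cases Z) (simp add: cvec_def ccoord_def euclidean_representation)

lemma cvec_cong: "(\<And>b. b \<in> Basis \<Longrightarrow> p b = q b) \<Longrightarrow> cvec p = cvec q"
  by (simp add: cvec_def)

lemma cmult_Jc: "cmult Jc t Z = (Re t *\<^sub>R fst Z - Im t *\<^sub>R snd Z, Re t *\<^sub>R snd Z + Im t *\<^sub>R fst Z)"
  by (cases Z) (simp add: cmult_def Jc_def)

lemma ccoord_cmult: "ccoord (Z + cmult Jc t V) b = ccoord Z b + t * ccoord V b"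
  by (simp add: ccoord_def cmult_Jc complex_eq_iff algebra_simps)

lemma ccoord_eq: "ccoord Z b = of_real (fst Z \<bullet> b) + \<i> * of_real (snd Z \<bullet> b)"
  by (simp add: ccoord_def complex_eq_iff)

lemma continuous_on_ccoord [continuous_intros]:
  "continuous_on S f \<Longrightarrow> continuous_on S (\<lambda>x. ccoord (f x) b)"
  unfolding ccoord_eq by (intro continuous_intros)

lemma norm_ccoord_le: assumes "b \<in> Basis" shows "norm (ccoord Z b) \<le> norm Z"
proof -
  have "(fst Z \<bullet> b)^2 + (snd Z \<bullet> b)^2 \<le> (norm (fst Z))^2 + (norm (snd Z))^2"
    using Basis_le_norm[OF assms] by (intro add_mono) (metis power2_abs power_mono abs_ge_zero)+
  then show ?thesis by (simp add: ccoord_def cmod_def norm_prod_def)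
qed

text \<open>Substitute complex numbers for the real coordinates in the power series. Convergence at the single
real point \<open>a + t One\<close> is absolute and dominates the series wherever all complex coordinates have
modulus at most \<open>t\<close>, so by the M-test the sum is a uniform limit of polynomials there.\<close>
lemma real_analytic_complexify:
  fixes g :: "'a::euclidean_space \<Rightarrow> real"
  assumes g: "real_analytic_on g S" and a: "a \<in> S"
  obtains r gC where "r > 0" "holo_on Jc ((*) \<i>) gC (ball 0 r)"
    "\<And>X. norm X < r \<Longrightarrow> gC (X, 0) = complex_of_real (g (a + X))"
proof -
  define A where "A = {\<alpha> :: 'a \<Rightarrow> nat. \<forall>b. b \<notin> Basis \<longrightarrow> \<alpha> b = 0}"
  obtain r c where r: "r > 0" and c: "\<And>x. x \<in> ball a r \<Longrightarrow>
      ((\<lambda>\<alpha>. (\<Prod>b\<in>Basis. ((x - a) \<bullet> b) ^ \<alpha> b) *\<^sub>R c \<alpha>) has_sum g x) A"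
    using g a unfolding real_analytic_on_def A_def by blast
  \<comment> \<open>A factor for which \<open>a + t One\<close> lies in the ball of convergence.\<close>
  define t where "t = r / (2 * (norm (One :: 'a) + 1))"
  have t: "t > 0" "t * norm (One :: 'a) < r" "t \<le> r"
  proof -
    have n: "norm (One :: 'a) + 1 > 0" by (smt (verit) norm_ge_zero)
    show "t > 0" using r n by (simp add: t_def)
    have "t * (2 * (norm (One :: 'a) + 1)) = r" using n by (simp add: t_def)
    then have *: "2 * (t * norm (One :: 'a)) + 2 * t = r" by (simp add: algebra_simps)
    moreover have "t * norm (One :: 'a) \<ge> 0" using \<open>t > 0\<close> by simp
    ultimately show "t * norm (One :: 'a) < r" "t \<le> r" using \<open>t > 0\<close> by linarith+
  qed
  define M where "M = (\<lambda>\<alpha>. (\<Prod>b\<in>(Basis::'a set). t ^ \<alpha> b) * \<bar>c \<alpha>\<bar>)"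
  have "((\<lambda>\<alpha>. (\<Prod>b\<in>(Basis::'a set). t ^ \<alpha> b) *\<^sub>R c \<alpha>) has_sum g (a + t *\<^sub>R One)) A"
    using c[of "a + t *\<^sub>R One"] t by (simp add: dist_norm cong: prod.cong)
  then have "(\<lambda>\<alpha>. (\<Prod>b\<in>(Basis::'a set). t ^ \<alpha> b) *\<^sub>R c \<alpha>) summable_on A"
    by (rule has_sum_imp_summable)
  then have "(\<lambda>\<alpha>. norm ((\<Prod>b\<in>(Basis::'a set). t ^ \<alpha> b) *\<^sub>R c \<alpha>)) summable_on A"
    by (subst (asm) summable_on_iff_abs_summable_on_real) simp
  then have M: "M summable_on A"
    using t(1) by (simp add: M_def abs_mult prod_nonneg flip: prod_power_distrib)
  define F where "F = (\<lambda>\<alpha> Z. (\<Prod>b\<in>(Basis::'a set). ccoord Z b ^ \<alpha> b) * complex_of_real (c \<alpha>))"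
  define gC where "gC = (\<lambda>Z. \<Sum>\<^sub>\<infinity>\<alpha>\<in>A. F \<alpha> Z)"
  have "uniform_limit (ball 0 t) (\<lambda>X Z. \<Sum>\<alpha>\<in>X. F \<alpha> Z) gC (finite_subsets_at_top A)"
    unfolding gC_def
  proof (rule Weierstrass_m_test_general[OF _ M])
    fix \<alpha> and Z :: "'a \<times> 'a" assume "Z \<in> ball 0 t"
    then have "norm (ccoord Z b) \<le> t" if "b \<in> Basis" for b
      using norm_ccoord_le[OF that, of Z] by auto
    then have "(\<Prod>b\<in>(Basis::'a set). norm (ccoord Z b) ^ \<alpha> b) \<le> (\<Prod>b\<in>(Basis::'a set). t ^ \<alpha> b)"
      by (intro prod_mono) (auto intro!: power_mono)
    then show "norm (F \<alpha> Z) \<le> M \<alpha>"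
      by (simp add: F_def M_def norm_mult prod_norm norm_power mult_right_mono flip: prod_norm)
  qed
  note ul = this
  have Fcont: "continuous_on T (\<lambda>Z. \<Sum>\<alpha>\<in>X. F \<alpha> Z)" for X T
    unfolding F_def by (intro continuous_intros)
  have "Jc.line_holo_on gC (ball 0 t)"
    unfolding Jc.line_holo_on_def
  proof (intro conjI ballI allI)
    show "continuous_on (ball 0 t) gC"
      by (rule uniform_limit_theorem[OF _ ul]) (auto intro!: Fcont always_eventually)
    fix Z V :: "'a \<times> 'a" assume Z: "Z \<in> ball 0 t"
    have "open {s. Z + cmult Jc s V \<in> ball 0 t}" by (rule Jc.open_line) simp
    moreover have "0 \<in> {s. Z + cmult Jc s V \<in> ball 0 t}" using Z by simp
    ultimately obtain e where e: "e > 0" "cball 0 e \<subseteq> {s. Z + cmult Jc s V \<in> ball 0 t}"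
      using open_contains_cball by blast
    have hol: "(\<lambda>s. \<Sum>\<alpha>\<in>X. F \<alpha> (Z + cmult Jc s V)) holomorphic_on T" for X T
      unfolding F_def ccoord_cmult by (intro holomorphic_intros)
    have "uniform_limit (cball 0 e) (\<lambda>X s. \<Sum>\<alpha>\<in>X. F \<alpha> (Z + cmult Jc s V))
       (\<lambda>s. gC (Z + cmult Jc s V)) (finite_subsets_at_top A)"
      by (rule uniform_limit_compose'[OF ul]) (use e in auto)
    then obtain "(\<lambda>s. gC (Z + cmult Jc s V)) holomorphic_on ball 0 e"
      by (rule holomorphic_uniform_limit[rotated])
         (auto intro!: always_eventually hol holomorphic_on_imp_continuous_on)
    then show "(\<lambda>s. gC (Z + cmult Jc s V)) field_differentiable at 0"
      using e(1) by (auto intro: holomorphic_on_imp_differentiable_at)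
  qed
  then have "holo_on Jc ((*) \<i>) gC (ball 0 t)"
    by (rule Jc.line_holo_imp_holo) simp
  moreover have "gC (X, 0) = complex_of_real (g (a + X))" if X: "norm X < t" for X
  proof -
    have "((\<lambda>\<alpha>. complex_of_real ((\<Prod>b\<in>Basis. (X \<bullet> b) ^ \<alpha> b) *\<^sub>R c \<alpha>)) has_sum of_real (g (a + X))) A"
      using c[of "a + X"] X t by (intro has_sum_of_real) (auto simp: dist_norm)
    moreover have "complex_of_real ((\<Prod>b\<in>Basis. (X \<bullet> b) ^ \<alpha> b) *\<^sub>R c \<alpha>) = F \<alpha> (X, 0)" for \<alpha>
      by (simp add: F_def ccoord_eq)
    ultimately show ?thesis unfolding gC_def by (simp add: infsumI)
  qed
  ultimately show ?thesis using t(1) that by blast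
qed


section \<open>Holomorphic curves and integrals over the circle\<close>
definition polydisc :: "real \<Rightarrow> ('a::euclidean_space \<times> 'a) set" where
  "polydisc R = {Z. \<forall>b\<in>Basis. norm (ccoord Z b) < R}"

lemma open_polydisc: "open (polydisc R :: ('a::euclidean_space \<times> 'a) set)"
proof -
  have "polydisc R = (\<Inter>b\<in>(Basis :: 'a set). {Z. norm (ccoord Z b) < R})"
    by (auto simp: polydisc_def)
  then show ?thesis
    by (auto intro!: open_INT open_Collect_less continuous_intros)
qed

lemma convex_polydisc: "convex (polydisc R)"
  unfolding convex_def
proof (intro ballI allI impI)
  fix x y :: "'a \<times> 'a" and u v :: real
  assume *: "x \<in> polydisc R" "y \<in> polydisc R" "0 \<le> u" "0 \<le> v" "u + v = 1"
  have "norm (ccoord (u *\<^sub>R x + v *\<^sub>R y) b) < R" if b: "b \<in> Basis" for b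
  proof -
    have "ccoord (u *\<^sub>R x + v *\<^sub>R y) b = u *\<^sub>R ccoord x b + v *\<^sub>R ccoord y b"
      by (simp add: ccoord_def complex_eq_iff inner_add_left)
    moreover have "ccoord x b \<in> ball 0 R" "ccoord y b \<in> ball 0 R"
      using * b by (auto simp: polydisc_def)
    then have "u *\<^sub>R ccoord x b + v *\<^sub>R ccoord y b \<in> ball 0 R"
      using *(3-5) convex_ball[of "0::complex" R] by (simp add: convex_def)
    ultimately show ?thesis by simp
  qed
  then show "u *\<^sub>R x + v *\<^sub>R y \<in> polydisc R" by (simp add: polydisc_def)
qed

lemma polydisc_mono: "r \<le> R \<Longrightarrow> polydisc r \<subseteq> polydisc R"
  by (force simp: polydisc_def)

lemma holo_on_cvec:
  assumes p: "\<And>b. b \<in> Basis \<Longrightarrow> p b holomorphic_on T" and T: "open T"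
  shows "holo_on ((*) \<i>) Jc (\<lambda>t. cvec (\<lambda>b. p b t)) T"
  unfolding holo_on_def
proof (intro ballI exI conjI allI)
  fix t assume t: "t \<in> T"
  let ?d = "\<lambda>b. deriv (p b) t"
  have d: "(p b has_derivative (\<lambda>h. ?d b * h)) (at t)" if "b \<in> Basis" for b
    using holomorphic_derivI[OF p[OF that] T t] by (simp add: has_field_derivative_def)
  show "((\<lambda>t. cvec (\<lambda>b. p b t)) has_derivative (\<lambda>h. cvec (\<lambda>b. ?d b * h))) (at t)"
    unfolding cvec_def
    by (intro has_derivative_Pair has_derivative_sum has_derivative_scaleR_left
        bounded_linear.has_derivative[OF bounded_linear_Re]
        bounded_linear.has_derivative[OF bounded_linear_Im] d)
  show "cvec (\<lambda>b. ?d b * (\<i> * h)) = Jc (cvec (\<lambda>b. ?d b * h))" for h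
    by (simp add: cvec_def Jc_def algebra_simps flip: sum_negf)
qed

context complex_structure
begin

text \<open>On each complex line: Fubini moves the integral over the sides of a triangle inside, where
Cauchy's theorem makes it vanish, and Morera's theorem applies.\<close>
lemma line_holo_circle_integral:
  assumes D: "open D"
    and K: "continuous_on (D \<times> sphere 0 1) (\<lambda>(Z, u). K Z u)"
    and hol: "\<And>u Z V. u \<in> sphere 0 1 \<Longrightarrow> Z \<in> D \<Longrightarrow>
        (\<lambda>t. K (Z + cmult J t V) u) field_differentiable at 0"
  shows "line_holo_on (\<lambda>Z. contour_integral (circlepath 0 1) (K Z)) D"
proof -
  let ?C = "circlepath 0 1"
  have param: "continuous_on A (\<lambda>x. contour_integral ?C (k x))"
    if "continuous_on (A \<times> sphere 0 1) (\<lambda>(x, u). k x u)" for A and k :: "'b::topological_space \<Rightarrow> complex \<Rightarrow> complex"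
  proof -
    have "continuous_on (A \<times> cbox 0 1) (\<lambda>x. (case (fst x, ?C (snd x)) of (x, u) \<Rightarrow> k x u))"
      by (rule continuous_on_compose2[OF that])
         (auto intro!: continuous_intros simp: circlepath norm_mult)
    then have "continuous_on (A \<times> cbox 0 1) (\<lambda>(x, s). k x (?C s) * vector_derivative ?C (at s))"
      unfolding vector_derivative_circlepath split_beta
      by (intro continuous_intros) simp
    then show ?thesis
      unfolding contour_integral_integral cbox_interval[symmetric]
      by (rule integral_continuous_on_param)
  qed
  have Kline: "continuous_on D (\<lambda>Z. K Z u)" if "u \<in> sphere 0 1" for u
  proof -
    have "continuous_on D (\<lambda>Z. case (Z, u) of (Z, u) \<Rightarrow> K Z u)"
      by (rule continuous_on_compose2[OF K]) (use that in \<open>auto intro!: continuous_intros\<close>)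
    then show ?thesis by simp
  qed
  have lh: "line_holo_on (\<lambda>Z. K Z u) D" if "u \<in> sphere 0 1" for u
    unfolding line_holo_on_def using Kline hol that by auto
  have "(\<lambda>t. contour_integral ?C (K (Z + cmult J t V))) field_differentiable at 0"
    if Z: "Z \<in> D" for Z V
  proof -
    let ?T = "{t. Z + cmult J t V \<in> D}"
    define k where "k = (\<lambda>t u. K (Z + cmult J t V) u)"
    have T: "open ?T" by (rule open_line[OF D])
    have k: "continuous_on (?T \<times> sphere 0 1) (\<lambda>(t, u). k t u)"
      unfolding k_def split_beta
      using linear_continuous_on[OF bounded_linear_cmult_left[of V], of UNIV]
      by (intro continuous_on_compose2[OF K, of _ "\<lambda>x. (Z + cmult J (fst x) V, snd x)", unfolded split_beta, simplified])
         (auto intro!: continuous_intros continuous_on_compose2[of UNIV "\<lambda>t. cmult J t V"])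
    have "(\<lambda>t. contour_integral ?C (k t)) analytic_on ?T"
    proof (rule Morera_triangle[OF param[OF k] T], intro impI)
      fix a b c assume abc: "convex hull {a, b, c} \<subseteq> ?T"
      have seg: "closed_segment a b \<subseteq> ?T" "closed_segment b c \<subseteq> ?T" "closed_segment c a \<subseteq> ?T"
      proof -
        have "closed_segment p q \<subseteq> convex hull {a, b, c}" if "p \<in> {a, b, c}" "q \<in> {a, b, c}" for p q
          using that by (intro closed_segment_subset convex_convex_hull) (auto intro: hull_inc)
        with abc show "closed_segment a b \<subseteq> ?T" "closed_segment b c \<subseteq> ?T" "closed_segment c a \<subseteq> ?T"
          by (meson insertCI order_trans)+
      qed
      let ?I = "\<lambda>p q u. contour_integral (linepath p q) (\<lambda>t. k t u)"
      have Icont: "continuous_on (sphere 0 1) (?I p q)" if "closed_segment p q \<subseteq> ?T" for p q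
      proof -
        have "continuous_on (sphere 0 1 \<times> cbox 0 1)
          (\<lambda>x. (case (linepath p q (snd x), fst x) of (t, u) \<Rightarrow> k t u))"
          by (rule continuous_on_compose2[OF k])
             (use that in \<open>auto intro!: continuous_intros continuous_on_compose2[OF continuous_on_linepath]
               simp: path_image_def linepath_in_path subset_iff\<close>)
        then have "continuous_on (sphere 0 1 \<times> cbox 0 1)
          (\<lambda>(u, s). k (linepath p q s) u * vector_derivative (linepath p q) (at s))"
          unfolding split_beta by (simp add: continuous_on_mult_right)
        then show ?thesis
          unfolding contour_integral_integral cbox_interval[symmetric]
          by (rule integral_continuous_on_param)
      qed
      have Iint: "?I p q contour_integrable_on ?C" if "closed_segment p q \<subseteq> ?T" for p q
        using contour_integrable_continuous_circlepath[of 0 1 "?I p q"] Icont[OF that] by simp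
      have swap: "contour_integral (linepath p q) (\<lambda>t. contour_integral ?C (k t))
          = contour_integral ?C (?I p q)" if "closed_segment p q \<subseteq> ?T" for p q
      proof (rule contour_integral_swap)
        show "continuous_on (path_image (linepath p q) \<times> path_image ?C) (\<lambda>(t, u). k t u)"
          using that by (intro continuous_on_subset[OF k]) auto
        show "continuous_on {0..1} (\<lambda>t. vector_derivative ?C (at t))"
          unfolding vector_derivative_circlepath by (intro continuous_intros)
      qed auto
      have zero: "?I a b u + ?I b c u + ?I c a u = 0" if u: "u \<in> sphere 0 1" for u
      proof -
        have "(\<lambda>t. k t u) holomorphic_on convex hull {a, b, c}"
          unfolding k_def
          by (rule holomorphic_on_subset[OF line_holo_on_holomorphic[OF lh[OF u]] abc])
        then show ?thesis
          by (intro has_chain_integral_chain_integral3 Cauchy_theorem_triangle)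
      qed
      have "contour_integral ?C (?I a b) + contour_integral ?C (?I b c) + contour_integral ?C (?I c a)
        = contour_integral ?C (\<lambda>u. ?I a b u + ?I b c u + ?I c a u)"
        using seg by (simp add: contour_integral_add contour_integrable_add Iint)
      also have "\<dots> = contour_integral ?C (\<lambda>u. 0)"
        by (rule contour_integral_cong) (use zero in auto)
      finally show "contour_integral (linepath a b) (\<lambda>t. contour_integral ?C (k t)) +
          contour_integral (linepath b c) (\<lambda>t. contour_integral ?C (k t)) +
          contour_integral (linepath c a) (\<lambda>t. contour_integral ?C (k t)) = 0"
        using seg swap by simp
    qed
    then have "(\<lambda>t. contour_integral ?C (k t)) field_differentiable at 0"
      using Z T by (intro holomorphic_on_imp_differentiable_at[of _ ?T] analytic_imp_holomorphic) auto
    then show ?thesis by (simp add: k_def)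
  qed
  with param[OF K] show ?thesis unfolding line_holo_on_def by blast
qed

end

section \<open>The edge of the wedge with reflection\<close>

text \<open>Rudin's Moebius transformation \<open>(\<omega> + u/c) / (1 + c u \<omega>)\<close> for \<open>c = 1/2\<close>. It equals \<open>\<omega>\<close> at \<open>u = 0\<close>,
and its imaginary part has the sign of \<open>Im u\<close> both when \<open>u\<close> is on the unit circle and when \<open>\<omega>\<close> is
real. Hence, applied in all coordinates at once, it attaches to every point of the unit polydisc a
circle that runs in the union of two opposite wedges and their edge, and to every real point a
whole disc with that property, centred at this point.\<close>
definition rudin :: "complex \<Rightarrow> complex \<Rightarrow> complex" where
  "rudin \<omega> u = (2 * \<omega> + 4 * u) / (2 + u * \<omega>)"

lemma rudin_denom:
  fixes \<omega> u :: complex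
  assumes "norm \<omega> < 1" "norm u \<le> 1"
  shows "norm (2 + u * \<omega>) > 1" "2 + u * \<omega> \<noteq> 0"
proof -
  have "norm (u * \<omega>) \<le> 1 * norm \<omega>"
    unfolding norm_mult using assms by (intro mult_right_mono) auto
  then have "norm (u * \<omega>) < 1" using assms by simp
  then show *: "norm (2 + u * \<omega>) > 1"
    using norm_diff_ineq[of 2 "u * \<omega>"] by simp
  then show "2 + u * \<omega> \<noteq> 0" by (metis norm_zero not_one_less_zero)
qed

lemma norm_rudin:
  assumes "norm \<omega> < 1" "norm u \<le> 1" shows "norm (rudin \<omega> u) < 6"
proof -
  have "norm (2 * \<omega> + 4 * u) \<le> norm (2 * \<omega>) + norm (4 * u)" by (rule norm_triangle_ineq)
  also have "\<dots> < 6" using assms by (simp add: norm_mult)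
  also have "6 < 6 * norm (2 + u * \<omega>)" using rudin_denom[OF assms] by simp
  finally show ?thesis using rudin_denom[OF assms] by (simp add: rudin_def norm_divide divide_less_eq)
qed

lemma Im_rudin:
  "Im (rudin \<omega> u) = (4 * (1 - (norm u)^2) * Im \<omega> + (8 - 2 * (norm \<omega>)^2) * Im u) / (norm (2 + u * \<omega>))^2"
  unfolding rudin_def Im_divide cmod_power2
  by (rule arg_cong2[where f="(/)"]) (auto simp: algebra_simps power2_eq_square)

text \<open>In the formula for the imaginary part the term with \<open>Im \<omega>\<close> drops out, and the coefficient of \<open>Im u\<close>
is positive.\<close>
lemma Im_rudin_sign:
  assumes "norm \<omega> < 1" "norm u \<le> 1" "norm u = 1 \<or> Im \<omega> = 0"
  shows "Im u > 0 \<Longrightarrow> Im (rudin \<omega> u) > 0" "Im u < 0 \<Longrightarrow> Im (rudin \<omega> u) < 0"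
    "Im u = 0 \<Longrightarrow> Im (rudin \<omega> u) = 0"
proof -
  have "(norm \<omega>)^2 < 1" using assms(1) by (simp add: abs_square_less_1)
  then have p: "8 - 2 * (norm \<omega>)^2 > 0" by linarith
  have d: "(norm (2 + u * \<omega>))^2 > 0" using rudin_denom[OF assms(1,2)] by simp
  have e: "4 * (1 - (norm u)^2) * Im \<omega> = 0" using assms(3) by auto
  show "Im u > 0 \<Longrightarrow> Im (rudin \<omega> u) > 0" "Im u < 0 \<Longrightarrow> Im (rudin \<omega> u) < 0"
    "Im u = 0 \<Longrightarrow> Im (rudin \<omega> u) = 0"
    using p d unfolding Im_rudin e by (auto simp: divide_neg_pos mult_pos_neg)
qed

lemma rudin_0 [simp]: "rudin \<omega> 0 = \<omega>" by (simp add: rudin_def)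

text \<open>The circles pass through the edge at \<open>u = 1\<close> and \<open>u = -1\<close>, always in the same two points. This is
why the value there does not disturb the holomorphic dependence on \<open>\<omega>\<close>.\<close>
lemma rudin_real_unit:
  assumes "norm \<omega> < 1" "norm u = 1" "Im u = 0" shows "rudin \<omega> u = 2 * u"
proof -
  have "\<bar>Re u\<bar> = 1" using assms(2,3) by (simp add: cmod_def)
  then have "u = 1 \<or> u = -1" using assms(3) by (auto simp: complex_eq_iff)
  then have "2 * \<omega> + 4 * u = 2 * u * (2 + u * \<omega>)" by auto
  then show ?thesis using rudin_denom(2)[of \<omega> u] assms by (simp add: rudin_def divide_eq_eq)
qed

definition rudin_disc :: "'a::euclidean_space \<times> 'a \<Rightarrow> complex \<Rightarrow> 'a \<times> 'a" where
  "rudin_disc Z u = cvec (\<lambda>b. rudin (ccoord Z b) u)"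

lemma rudin_disc_0 [simp]: "rudin_disc Z 0 = Z"
  by (simp add: rudin_disc_def)

lemma snd_cvec_inner: "b \<in> Basis \<Longrightarrow> snd (cvec p) \<bullet> b = Im (p b)"
  by (metis ccoord_cvec ccoord_def complex.sel(2))

lemma continuous_on_cvec [continuous_intros]:
  assumes "\<And>b. b \<in> Basis \<Longrightarrow> continuous_on S (p b)"
  shows "continuous_on S (\<lambda>x. cvec (\<lambda>b. p b x))"
  unfolding cvec_def using assms by (intro continuous_intros) auto

lemma continuous_on_rudin_disc:
  "continuous_on (polydisc 1 \<times> cball 0 1) (\<lambda>x. rudin_disc (fst x) (snd x))"
  unfolding rudin_disc_def rudin_def
  by (intro continuous_intros ballI) (auto simp: polydisc_def dest!: rudin_denom(2)[rotated])

definition orthant_wedge :: "('a::euclidean_space \<times> 'a) set" where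
  "orthant_wedge = {Z. \<forall>b\<in>Basis. snd Z \<bullet> b > 0}"

definition opp_wedge :: "('a::euclidean_space \<times> 'a) set" where
  "opp_wedge = {Z. \<forall>b\<in>Basis. snd Z \<bullet> b < 0}"

definition real_edge :: "('a::euclidean_space \<times> 'a) set" where
  "real_edge = {Z. snd Z = 0}"

lemma rudin_disc_range:
  assumes "Z \<in> polydisc 1" "norm u \<le> 1" "norm u = 1 \<or> Z \<in> real_edge"
  shows "rudin_disc Z u \<in> polydisc 6"
    "Im u > 0 \<Longrightarrow> rudin_disc Z u \<in> orthant_wedge"
    "Im u < 0 \<Longrightarrow> rudin_disc Z u \<in> opp_wedge"
    "Im u = 0 \<Longrightarrow> rudin_disc Z u \<in> real_edge"
proof -
  have n: "norm (ccoord Z b) < 1" if "b \<in> Basis" for b using assms(1) that by (simp add: polydisc_def)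
  have i: "norm u = 1 \<or> Im (ccoord Z b) = 0" for b
    using assms(3) by (auto simp: ccoord_def real_edge_def)
  show "rudin_disc Z u \<in> polydisc 6"
    using norm_rudin[OF n assms(2)] by (simp add: polydisc_def rudin_disc_def)
  show "Im u > 0 \<Longrightarrow> rudin_disc Z u \<in> orthant_wedge"
    "Im u < 0 \<Longrightarrow> rudin_disc Z u \<in> opp_wedge"
    using Im_rudin_sign(1,2)[OF n assms(2) i]
    by (auto simp: orthant_wedge_def opp_wedge_def rudin_disc_def snd_cvec_inner)
  assume u: "Im u = 0"
  have "snd (rudin_disc Z u) = 0"
  proof (rule euclidean_eqI)
    fix b :: 'a assume b: "b \<in> Basis"
    show "snd (rudin_disc Z u) \<bullet> b = 0 \<bullet> b"
      using Im_rudin_sign(3)[OF n[OF b] assms(2) i u] b by (simp add: rudin_disc_def snd_cvec_inner)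
  qed
  then show "rudin_disc Z u \<in> real_edge" by (simp add: real_edge_def)
qed

lemma open_orthant: "open (orthant_wedge :: ('a::euclidean_space \<times> 'a) set)" "open (opp_wedge :: ('a \<times> 'a) set)"
proof -
  have "orthant_wedge = (\<Inter>b\<in>(Basis :: 'a set). {Z::'a\<times>'a. 0 < snd Z \<bullet> b})"
    "opp_wedge = (\<Inter>b\<in>(Basis :: 'a set). {Z::'a\<times>'a. snd Z \<bullet> b < 0})"
    by (auto simp: orthant_wedge_def opp_wedge_def)
  moreover have "open (\<Inter>b\<in>(Basis :: 'a set). {Z::'a\<times>'a. 0 < snd Z \<bullet> b})"
    "open (\<Inter>b\<in>(Basis :: 'a set). {Z::'a\<times>'a. snd Z \<bullet> b < 0})"
    by (intro open_INT finite_Basis ballI open_Collect_less continuous_intros)+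
  ultimately show "open (orthant_wedge :: ('a \<times> 'a) set)" "open (opp_wedge :: ('a \<times> 'a) set)"
    by simp_all
qed

definition cconj :: "'a::euclidean_space \<times> 'a \<Rightarrow> 'a \<times> 'a" where "cconj Z = (fst Z, - snd Z)"

text \<open>Conjugation in the source and in the target each anticommute with the complex structure.\<close>
lemma holo_on_reflect:
  assumes g: "holo_on Jc ((*) \<i>) g S" and T: "cconj ` T \<subseteq> S"
  shows "holo_on Jc ((*) \<i>) (\<lambda>Z. cnj (g (cconj Z))) T"
  unfolding holo_on_def
proof
  fix Z :: "'a \<times> 'a" assume "Z \<in> T"
  then obtain g' where g': "(g has_derivative g') (at (cconj Z))" "\<And>V. g' (Jc V) = \<i> * g' V"
    using g T unfolding holo_on_def by blast
  interpret g': bounded_linear g' using g'(1) by (rule has_derivative_bounded_linear)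
  have c: "(cconj has_derivative cconj) (at Z)"
  proof -
    have eq: "cconj = (\<lambda>Z::'a\<times>'a. (fst Z, - snd Z))" by (auto simp: cconj_def)
    show ?thesis
      unfolding eq by (intro has_derivative_Pair has_derivative_minus has_derivative_fst has_derivative_snd has_derivative_ident)
  qed
  have "((\<lambda>Z. cnj (g (cconj Z))) has_derivative (\<lambda>V. cnj (g' (cconj V)))) (at Z)"
    using bounded_linear.has_derivative[OF bounded_linear_cnj diff_chain_at[OF c g'(1)]] by (simp add: o_def)
  moreover have "cnj (g' (cconj (Jc V))) = \<i> * cnj (g' (cconj V))" for V
  proof -
    have "cconj (Jc V) = - Jc (cconj V)" by (simp add: cconj_def Jc_def)
    then show ?thesis by (simp add: g'.neg g'(2))
  qed
  ultimately show "\<exists>h'. ((\<lambda>Z. cnj (g (cconj Z))) has_derivative h') (at Z) \<and> (\<forall>V. h' (Jc V) = \<i> * h' V)"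
    by blast
qed

lemma holo_on_const: "holo_on J ((*) \<i>) (\<lambda>_. c) S"
  unfolding holo_on_def by (auto intro!: exI[of _ "\<lambda>_. 0"])

text \<open>Extend \<open>g\<close> to the opposite wedge by Schwarz reflection, which is continuous across the edge because
\<open>g\<close> is real there. The extension \<open>F\<close> is the mean value of the result over Rudin's circles: these
stay where it is defined, for all points of the unit polydisc, and depend holomorphically on the
point. At a real point the circle bounds a disc, and the mean value property gives \<open>F = g\<close>. From the
edge this equality spreads along the rays \<open>X + tY\<close>, on which the difference vanishes for real \<open>t\<close>
and can be continued by zero to \<open>Im t < 0\<close>.\<close>
theorem edge_of_the_wedge_reflection:
  fixes g :: "'a::euclidean_space \<times> 'a \<Rightarrow> complex"
  assumes cont: "continuous_on (polydisc 6 \<inter> (orthant_wedge \<union> real_edge)) g"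
    and hol: "holo_on Jc ((*) \<i>) g (polydisc 6 \<inter> orthant_wedge)"
    and re: "\<And>Z. Z \<in> polydisc 6 \<inter> real_edge \<Longrightarrow> Im (g Z) = 0"
  obtains F where "holo_on Jc ((*) \<i>) F (polydisc 1)"
    "\<And>Z. Z \<in> polydisc 1 \<inter> orthant_wedge \<Longrightarrow> F Z = g Z"
proof -
  let ?P = "polydisc 6 \<inter> orthant_wedge :: ('a \<times> 'a) set"
  let ?N = "polydisc 6 \<inter> opp_wedge :: ('a \<times> 'a) set"
  let ?E = "polydisc 6 \<inter> real_edge :: ('a \<times> 'a) set"
  define Q where "Q = ?P \<union> ?N \<union> ?E"
  \<comment> \<open>A continuous function that tells the two wedges apart and vanishes on the edge.\<close>
  define s where "s = (\<lambda>Z::'a\<times>'a. snd Z \<bullet> One)"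
  define h where "h = (\<lambda>Z. if s Z \<le> 0 then cnj (g (cconj Z)) else g Z)"
  have s_pos: "s Z > 0" if "Z \<in> orthant_wedge" for Z
    using that by (auto simp: s_def orthant_wedge_def inner_sum_right intro!: sum_pos)
  have s_neg: "s Z < 0" if "Z \<in> opp_wedge" for Z
  proof -
    have "0 < (\<Sum>b\<in>Basis. - (snd Z \<bullet> b))"
      using that by (intro sum_pos) (auto simp: opp_wedge_def)
    then show ?thesis by (simp add: s_def inner_sum_right sum_negf)
  qed
  have s_0: "s Z = 0" if "Z \<in> real_edge" for Z using that by (simp add: s_def real_edge_def)
  have conj_poly: "cconj Z \<in> polydisc 6" if "Z \<in> polydisc 6" for Z :: "'a \<times> 'a"
    using that by (simp add: polydisc_def ccoord_def cconj_def cmod_def)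
  have conj_N: "cconj ` ?N \<subseteq> ?P" and conj_E: "cconj ` ?E \<subseteq> ?E"
    using conj_poly by (auto simp: orthant_wedge_def opp_wedge_def real_edge_def cconj_def)
  have conj_cont: "continuous_on A cconj" for A :: "('a \<times> 'a) set"
    unfolding cconj_def by (intro continuous_intros)
  have h_cont: "continuous_on Q h"
    unfolding h_def
  proof (rule continuous_on_cases_le)
    have "{x \<in> Q. s x \<le> 0} \<subseteq> ?N \<union> ?E" using s_pos by (force simp: Q_def)
    then have "cconj ` {x \<in> Q. s x \<le> 0} \<subseteq> polydisc 6 \<inter> (orthant_wedge \<union> real_edge)"
      using conj_N conj_E by blast
    then show "continuous_on {x \<in> Q. s x \<le> 0} (\<lambda>Z. cnj (g (cconj Z)))"
      by (intro continuous_on_cnj continuous_on_compose2[OF cont conj_cont])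
    have "{x \<in> Q. 0 \<le> s x} \<subseteq> polydisc 6 \<inter> (orthant_wedge \<union> real_edge)"
      using s_neg by (force simp: Q_def)
    then show "continuous_on {x \<in> Q. 0 \<le> s x} g" by (rule continuous_on_subset[OF cont])
    show "continuous_on Q s" unfolding s_def by (intro continuous_intros)
    fix x assume "x \<in> Q" "s x = 0"
    then have "x \<in> ?E" using s_pos s_neg by (fastforce simp: Q_def)
    moreover from this have "cconj x = x" by (cases x) (simp add: real_edge_def cconj_def)
    ultimately show "cnj (g (cconj x)) = g x" using re[of x] by (simp add: complex_eq_iff)
  qed
  have openP: "open ?P" and openN: "open ?N"
    using open_polydisc open_orthant by (auto intro!: open_Int)
  have h_holP: "holo_on Jc ((*) \<i>) h ?P"
    by (rule holo_on_cong[OF openP _ hol]) (use s_pos in \<open>force simp: h_def\<close>)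
  have h_holN: "holo_on Jc ((*) \<i>) h ?N"
    by (rule holo_on_cong[OF openN _ holo_on_reflect[OF hol conj_N]]) (use s_neg in \<open>force simp: h_def\<close>)
  have disc_Q: "rudin_disc Z u \<in> Q"
    if "Z \<in> polydisc 1" "norm u \<le> 1" "norm u = 1 \<or> Z \<in> real_edge" for Z :: "'a \<times> 'a" and u
    using rudin_disc_range[OF that] unfolding Q_def by (cases "Im u" "0::real" rule: linorder_cases) auto
  define K where "K = (\<lambda>Z u. h (rudin_disc Z u) / u)"
  define G where "G = (\<lambda>Z. contour_integral (circlepath 0 1) (K Z))"
  define F where "F = (\<lambda>Z. 0 + (1 / (2 * of_real pi * \<i>)) * G Z)"
  have "Jc.line_holo_on G (polydisc 1)"
    unfolding G_def
  proof (rule Jc.line_holo_circle_integral[OF open_polydisc])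
    have "continuous_on (polydisc 1 \<times> sphere 0 1) (\<lambda>x. h (rudin_disc (fst x) (snd x)))"
      by (rule continuous_on_compose2[OF h_cont continuous_on_subset[OF continuous_on_rudin_disc]])
         (auto intro!: disc_Q)
    then show "continuous_on (polydisc 1 \<times> sphere 0 1) (\<lambda>(Z, u). K Z u)"
      unfolding K_def split_beta by (intro continuous_intros) auto
    fix u :: complex and Z V :: "'a \<times> 'a" assume u: "u \<in> sphere 0 1" and Z: "Z \<in> polydisc 1"
    let ?T = "{t. Z + cmult Jc t V \<in> polydisc 1}"
    have T: "open ?T" by (rule Jc.open_line[OF open_polydisc])
    have curve: "holo_on ((*) \<i>) Jc (\<lambda>t. rudin_disc (Z + cmult Jc t V) u) ?T"
      unfolding rudin_disc_def
    proof (rule holo_on_cvec[OF _ T])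
      fix b :: 'a assume b: "b \<in> Basis"
      have "2 + u * (ccoord Z b + t * ccoord V b) \<noteq> 0" if "t \<in> ?T" for t
        using that b u rudin_denom(2)[of "ccoord (Z + cmult Jc t V) b" u]
        by (auto simp: polydisc_def ccoord_cmult)
      then show "(\<lambda>t. rudin (ccoord (Z + cmult Jc t V) b) u) holomorphic_on ?T"
        unfolding rudin_def ccoord_cmult by (intro holomorphic_intros) auto
    qed
    have "(\<lambda>t. h (rudin_disc (Z + cmult Jc t V) u)) holomorphic_on ?T"
    proof (cases "Im u" "0::real" rule: linorder_cases)
      case less
      show ?thesis
        by (intro holo_on_holomorphic_on holo_on_compose[OF curve h_holN])
           (use less u in \<open>auto intro!: rudin_disc_range\<close>)
    next
      case greater
      show ?thesis
        by (intro holo_on_holomorphic_on holo_on_compose[OF curve h_holP])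
           (use greater u in \<open>auto intro!: rudin_disc_range\<close>)
    next
      case equal
      have "rudin_disc Y u = cvec (\<lambda>_. 2 * u)" if "Y \<in> polydisc 1" for Y :: "'a \<times> 'a"
        unfolding rudin_disc_def
        by (rule cvec_cong) (use that u equal in \<open>auto simp: polydisc_def rudin_real_unit\<close>)
      then have "h (rudin_disc (Z + cmult Jc t V) u) = h (cvec (\<lambda>_. 2 * u))" if "t \<in> ?T" for t
        using that by simp
      then show ?thesis
        by (intro holomorphic_transform[OF holomorphic_on_const[of "h (cvec (\<lambda>_. 2 * u))"]]) auto
    qed
    then have "(\<lambda>t. K (Z + cmult Jc t V) u) holomorphic_on ?T"
      unfolding K_def using u by (intro holomorphic_intros) auto
    then show "(\<lambda>t. K (Z + cmult Jc t V) u) field_differentiable at 0"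
      using T Z by (intro holomorphic_on_imp_differentiable_at[of _ ?T]) auto
  qed
  then have F_hol: "holo_on Jc ((*) \<i>) F (polydisc 1)"
    unfolding F_def by (intro holo_on_add_scaled holo_on_const Jc.line_holo_imp_holo open_polydisc)
  have F_edge: "F Z = g Z" if Z: "Z \<in> polydisc 1" "Z \<in> real_edge" for Z
  proof -
    define k where "k = (\<lambda>u. h (rudin_disc Z u))"
    have k_cont: "continuous_on (cball 0 1) k"
      unfolding k_def
    proof (rule continuous_on_compose2[OF h_cont])
      show "continuous_on (cball 0 1) (rudin_disc Z)"
      proof -
        have "continuous_on (cball 0 1) (\<lambda>u. rudin_disc (fst (Z, u)) (snd (Z, u)))"
          by (rule continuous_on_compose2[OF continuous_on_rudin_disc])
             (use Z in \<open>auto intro!: continuous_intros\<close>)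
        then show ?thesis by simp
      qed
    qed (use Z in \<open>auto intro!: disc_Q simp: image_subset_iff\<close>)
    have curve: "holo_on ((*) \<i>) Jc (\<lambda>u. rudin_disc Z u) (ball 0 1)"
      unfolding rudin_disc_def
    proof (rule holo_on_cvec)
      fix b :: 'a assume b: "b \<in> Basis"
      have "2 + u * ccoord Z b \<noteq> 0" if "u \<in> ball 0 1" for u
        using that b Z rudin_denom(2)[of "ccoord Z b" u] by (auto simp: polydisc_def)
      then show "rudin (ccoord Z b) holomorphic_on ball 0 1"
        unfolding rudin_def by (intro holomorphic_intros) auto
    qed auto
    have "k holomorphic_on ball 0 1"
    proof (rule holomorphic_on_paste_across_line[of _ \<i> k 0])
      show "k holomorphic_on (ball 0 1 \<inter> {z. \<i> \<bullet> z < 0})"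
        unfolding k_def
        by (intro holo_on_holomorphic_on holo_on_compose[OF holo_on_subset[OF curve] h_holN])
           (use Z in \<open>auto simp: inner_complex_def intro!: rudin_disc_range\<close>)
      show "k holomorphic_on (ball 0 1 \<inter> {z. 0 < \<i> \<bullet> z})"
        unfolding k_def
        by (intro holo_on_holomorphic_on holo_on_compose[OF holo_on_subset[OF curve] h_holP])
           (use Z in \<open>auto simp: inner_complex_def intro!: rudin_disc_range\<close>)
      show "continuous_on (ball 0 1) k"
        using k_cont ball_subset_cball continuous_on_subset by blast
    qed auto
    then have "((\<lambda>u. k u / (u - 0)) has_contour_integral (2 * of_real pi * \<i> * k 0)) (circlepath 0 1)"
      by (intro Cauchy_integral_circlepath k_cont) auto
    then have "G Z = 2 * of_real pi * \<i> * k 0"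
      unfolding G_def K_def k_def by (simp add: contour_integral_unique)
    then have "F Z = h Z" by (simp add: F_def k_def)
    also have "cconj Z = Z" using Z by (cases Z) (simp add: real_edge_def cconj_def)
    then have "h Z = g Z"
      using Z re[of Z] s_0[of Z] polydisc_mono[of 1 6] by (auto simp: h_def complex_eq_iff)
    finally show ?thesis .
  qed
  have "F Z = g Z" if Z: "Z \<in> polydisc 1" "Z \<in> orthant_wedge" for Z
  proof -
    define X where "X = (fst Z, 0::'a)"
    define Y where "Y = (snd Z, 0::'a)"
    define D where "D = (\<lambda>t. X + cmult Jc t Y)"
    have D: "D t = (fst Z + Re t *\<^sub>R snd Z, Im t *\<^sub>R snd Z)" for t
      by (simp add: D_def X_def Y_def cmult_Jc)
    define T where "T = {t. D t \<in> polydisc 1}"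
    have T: "open T" "convex T"
      unfolding T_def D_def by (auto intro!: Jc.open_line Jc.convex_line open_polydisc convex_polydisc)
    have iT: "\<i> \<in> T" using Z by (simp add: T_def D)
    have zT: "0 \<in> T"
    proof -
      have "norm (ccoord (fst Z, 0) b) \<le> norm (ccoord Z b)" for b
        by (simp add: ccoord_def cmod_def)
      then show ?thesis using Z unfolding T_def mem_Collect_eq D polydisc_def
        by (auto intro: le_less_trans)
    qed
    have DP: "D t \<in> orthant_wedge" if "Im t > 0" for t
      using that Z by (auto simp: D orthant_wedge_def)
    have DE: "D t \<in> real_edge" if "Im t = 0" for t
      using that by (auto simp: D real_edge_def)
    have D6: "D t \<in> polydisc 6" if "t \<in> T" for t
      using that polydisc_mono[of 1 6] by (auto simp: T_def)
    have D_cont: "continuous_on A D" for A unfolding D by (intro continuous_intros)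
    define k where "k = (\<lambda>t. if Im t \<le> 0 then 0 else F (D t) - g (D t))"
    have k_cont: "continuous_on T k"
      unfolding k_def
    proof (rule continuous_on_cases_le)
      show "continuous_on {t \<in> T. 0 \<le> Im t} (\<lambda>t. F (D t) - g (D t))"
      proof (intro continuous_on_diff)
        show "continuous_on {t \<in> T. 0 \<le> Im t} (\<lambda>t. F (D t))"
          by (rule continuous_on_compose2[OF holo_on_imp_continuous_on[OF F_hol] D_cont]) (auto simp: T_def)
        show "continuous_on {t \<in> T. 0 \<le> Im t} (\<lambda>t. g (D t))"
          by (rule continuous_on_compose2[OF cont D_cont]) (use DP DE D6 in \<open>auto simp: le_less\<close>)
      qed
      show "0 = F (D t) - g (D t)" if "t \<in> T" "Im t = 0" for t
        using F_edge[of "D t"] DE[of t] that by (simp add: T_def)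
    qed (intro continuous_intros)+
    have k_hol: "k holomorphic_on T"
    proof (rule holomorphic_on_paste_across_line[of _ \<i> k 0, OF T(1) _ _ _ k_cont])
      show "k holomorphic_on (T \<inter> {z. \<i> \<bullet> z < 0})"
        using holomorphic_on_const[of 0] by (rule holomorphic_transform) (auto simp: k_def inner_complex_def)
      have "(\<lambda>t. F (D t) - g (D t)) holomorphic_on (T \<inter> {z. 0 < Im z})"
      proof (intro holomorphic_on_diff)
        show "(\<lambda>t. F (D t)) holomorphic_on (T \<inter> {z. 0 < Im z})"
          unfolding D_def by (rule holomorphic_on_subset[OF Jc.holomorphic_on_line[OF F_hol]]) (auto simp: T_def D_def)
        show "(\<lambda>t. g (D t)) holomorphic_on (T \<inter> {z. 0 < Im z})"
          unfolding D_def by (rule holomorphic_on_subset[OF Jc.holomorphic_on_line[OF hol]])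
            (use DP D6 in \<open>auto simp: D_def\<close>)
      qed
      moreover have "\<i> \<bullet> z = Im z" for z by (simp add: inner_complex_def)
      ultimately show "k holomorphic_on (T \<inter> {z. 0 < \<i> \<bullet> z})"
        by (auto simp: k_def intro: holomorphic_transform)
    qed auto
    have "k \<i> = 0"
    proof (rule analytic_continuation_open[of "T \<inter> {t. Im t < 0}" T k "\<lambda>_. 0"])
      show "open (T \<inter> {t. Im t < 0})" using T(1) by (intro open_Int open_halfspace_Im_lt)
      obtain e where e: "e > 0" "ball 0 e \<subseteq> T" using T(1) zT open_contains_ball by blast
      then have "- \<i> * of_real (e/2) \<in> T \<inter> {t. Im t < 0}" by (auto simp: subset_iff norm_mult)
      then show "T \<inter> {t. Im t < 0} \<noteq> {}" by blast
    qed (use T iT k_hol zT in \<open>auto simp: k_def convex_connected\<close>)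
    then show ?thesis by (simp add: k_def D)
  qed
  with F_hol that show ?thesis by blast
qed

section \<open>The holomorphic inverse function theorem\<close>
lemma Jc_holo_ccoord:
  assumes f: "holo_on J Jc f S"
  shows "holo_on J ((*) \<i>) (\<lambda>Z. ccoord (f Z) b) S"
proof (rule holo_on_compose[OF f])
  show "holo_on Jc ((*) \<i>) (\<lambda>Z. ccoord Z b) UNIV"
    unfolding holo_on_def
  proof (intro ballI exI conjI allI)
    fix Z :: "'b \<times> 'b"
    show "((\<lambda>Z. ccoord Z b) has_derivative (\<lambda>V. ccoord V b)) (at Z)"
      unfolding ccoord_eq
      by (auto intro!: derivative_eq_intros)
    show "ccoord (Jc V) b = \<i> * ccoord V b" for V :: "'b \<times> 'b"
      by (simp add: ccoord_def Jc_def complex_eq_iff)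
  qed
qed auto

text \<open>The real inverse function theorem applies since holomorphic maps are continuously differentiable;
the inverse of a bijection that commutes with \<open>Jc\<close> commutes with \<open>Jc\<close>.\<close>
lemma holo_inverse_function:
  fixes f :: "'a::euclidean_space \<times> 'a \<Rightarrow> 'a \<times> 'a"
  assumes f: "holo_on Jc Jc f U" and U: "open U" "Z0 \<in> U"
    and f0: "(f has_derivative f0) (at Z0)" and inj: "inj f0"
  obtains U' V g where "open U'" "U' \<subseteq> U" "Z0 \<in> U'" "open V" "homeomorphism U' V f g"
    "holo_on Jc Jc g V"
proof -
  define h where "h = (\<lambda>b Z. ccoord (f Z) b)"
  have h: "holo_on Jc ((*) \<i>) (h b) U" for b
    unfolding h_def by (rule Jc_holo_ccoord[OF f])
  note lh = Jc.holo_imp_line_holo[OF h U(1)]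
  define D where "D = (\<lambda>Z V. cvec (\<lambda>b. Jc.cdir (h b) Z V))"
  have D: "(f has_derivative D Z) (at Z)" "\<And>V. D Z (Jc V) = Jc (D Z V)" if Z: "Z \<in> U" for Z
  proof -
    obtain f' where f': "(f has_derivative f') (at Z)" "\<And>V. f' (Jc V) = Jc (f' V)"
      using f Z unfolding holo_on_def by blast
    have eq: "ccoord (f' V) b = Jc.cdir (h b) Z V" for b V
    proof -
      have "((\<lambda>Z. ccoord (f Z) b) has_derivative (\<lambda>V. ccoord (f' V) b)) (at Z)"
        unfolding ccoord_eq by (auto intro!: derivative_eq_intros f'(1))
      then show ?thesis
        using has_derivative_unique[OF Jc.line_holo_has_derivative[OF lh U(1) Z, of b]]
        unfolding h_def by metis
    qed
    have "D Z V = cvec (ccoord (f' V))" for V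
      unfolding D_def by (rule cvec_cong) (simp only: eq)
    then have "D Z = f'" by (intro ext) simp
    then show "(f has_derivative D Z) (at Z)" "\<And>V. D Z (Jc V) = Jc (D Z V)" using f' by auto
  qed
  define B where "B = (\<lambda>Z. Blinfun (D Z))"
  have B: "blinfun_apply (B Z) = D Z" if "Z \<in> U" for Z
    unfolding B_def by (rule bounded_linear_Blinfun_apply[OF has_derivative_bounded_linear[OF D(1)[OF that]]])
  have Bder: "(f has_derivative blinfun_apply (B Z)) (at Z)" if "Z \<in> U" for Z
    using D(1)[OF that] B[OF that] by simp
  have Bcont: "continuous_on U B"
  proof (rule continuous_on_blinfun_componentwise)
    fix i :: "'a \<times> 'a"
    have "continuous_on U (\<lambda>Z. D Z i)"
      unfolding D_def
      by (intro continuous_on_cvec continuous_at_imp_continuous_on ballI Jc.isCont_cdir[OF lh U(1)])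
    then show "continuous_on U (\<lambda>Z. blinfun_apply (B Z) i)"
      by (rule continuous_on_eq) (simp add: B)
  qed
  have "D Z0 = f0" by (rule has_derivative_unique[OF D(1)[OF U(2)] f0])
  then have "linear (D Z0)" "inj (D Z0)"
    using has_derivative_linear[OF f0] inj by auto
  then obtain k where k: "linear k" "k \<circ> D Z0 = id"
    using linear_injective_left_inverse by blast
  have "Blinfun k o\<^sub>L B Z0 = id_blinfun"
  proof (rule blinfun_eqI)
    fix x
    have "blinfun_apply (Blinfun k) = k"
      using k(1) by (simp add: bounded_linear_Blinfun_apply linear_conv_bounded_linear)
    then show "blinfun_apply (Blinfun k o\<^sub>L B Z0) x = blinfun_apply id_blinfun x"
      using fun_cong[OF k(2), of x] by (simp add: B[OF U(2)])
  qed
  from inverse_function_theorem[OF U(1) Bder Bcont U(2) this]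
  obtain U' V g g' where *: "open U'" "U' \<subseteq> U" "Z0 \<in> U'" "open V" "homeomorphism U' V f g"
    "\<And>y. y \<in> V \<Longrightarrow> (g has_derivative (g' y)) (at y)"
    "\<And>y. y \<in> V \<Longrightarrow> g' y = inv (blinfun_apply (B (g y)))"
    "\<And>y. y \<in> V \<Longrightarrow> bij (blinfun_apply (B (g y)))"
    by metis
  have "holo_on Jc Jc g V"
    unfolding holo_on_def
  proof (intro ballI exI conjI allI)
    fix y W assume y: "y \<in> V"
    show "(g has_derivative g' y) (at y)" by (rule *(6)[OF y])
    have gy: "g y \<in> U" using *(2,5) y by (auto simp: homeomorphism_def)
    have bij: "bij (D (g y))" and g'y: "g' y = inv (D (g y))" using *(7,8)[OF y] B[OF gy] by auto
    have "D (g y) (Jc (g' y W)) = Jc W"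
      using D(2)[OF gy] bij by (simp add: g'y surj_f_inv_f bij_is_surj)
    then show "g' y (Jc W) = Jc (g' y W)"
      using bij_inv_eq_iff[OF bij, of "Jc (g' y W)" "Jc W"] by (simp add: g'y)
  qed
  with *(1-5) that show ?thesis by blast
qed

section \<open>Complex coordinate vectors and their real and imaginary parts\<close>
lemma complex_structure_cscale: "complex_structure (cscale \<i> :: ('n::finite, 'd::finite) CC \<Rightarrow> _)"
proof (rule complex_structure.intro)
  show "linear (cscale \<i> :: ('n, 'd) CC \<Rightarrow> _)"
    by (rule linearI) (auto simp: cscale_def vec_eq_iff algebra_simps)
  show "cscale \<i> (cscale \<i> V) = - V" for V :: "('n, 'd) CC"
    by (cases V) (auto simp: cscale_def vec_eq_iff)
qed

interpretation CC: complex_structure "cscale \<i> :: ('n::finite, 'd::finite) CC \<Rightarrow> _"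
  by (rule complex_structure_cscale)

lemma cmult_cscale: "cmult (cscale \<i>) c V = cscale c V"
  by (cases V) (auto simp: cmult_def cscale_def vec_eq_iff complex_eq_iff)

lemma holomorphic_CC_on_iff:
  assumes S: "open S"
  shows "holomorphic_CC_on f S \<longleftrightarrow> holo_on (cscale \<i>) ((*) \<i>) f S"
proof
  assume "holomorphic_CC_on f S"
  then show "holo_on (cscale \<i>) ((*) \<i>) f S"
    unfolding holomorphic_CC_on_def holo_on_def using at_within_open[OF _ S] by metis
next
  assume h: "holo_on (cscale \<i>) ((*) \<i>) f S"
  show "holomorphic_CC_on f S"
    unfolding holomorphic_CC_on_def
  proof
    fix Z assume "Z \<in> S"
    then obtain f' where f': "(f has_derivative f') (at Z)" "\<And>V. f' (cscale \<i> V) = \<i> * f' V"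
      using h unfolding holo_on_def by blast
    interpret f': bounded_linear f' using f'(1) by (rule has_derivative_bounded_linear)
    have "f' (cscale c V) = c * f' V" for c V
    proof -
      have "f' (cscale c V) = f' (Re c *\<^sub>R V + Im c *\<^sub>R cscale \<i> V)"
        by (simp only: cmult_cscale flip: cmult_def)
      also have "\<dots> = Re c *\<^sub>R f' V + Im c *\<^sub>R (\<i> * f' V)"
        by (simp add: f'.add f'.scaleR f'(2))
      also have "\<dots> = c * f' V" by (simp add: complex_eq_iff)
      finally show ?thesis .
    qed
    then show "\<exists>f'. (f has_derivative f') (at Z within S) \<and> (\<forall>c V. f' (cscale c V) = c * f' V)"
      using f'(1) has_derivative_at_withinI by blast
  qed
qed

definition vec_complex :: "real ^ 'm \<Rightarrow> real ^ 'm \<Rightarrow> complex ^ 'm" where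
  "vec_complex x y = (\<chi> i. Complex (x $ i) (y $ i))"

lemma vec_complex_simps [simp]:
  "vec_Re (vec_complex x y) = x" "vec_Im (vec_complex x y) = y"
  "vec_complex (vec_Re w) (vec_Im w) = w"
  by (auto simp: vec_complex_def vec_Re_def vec_Im_def vec_eq_iff)

lemma linear_vec_complex: "linear (\<lambda>Z. vec_complex (f Z) (g Z))" if "linear f" "linear g"
  by (rule linearI) (use that in \<open>auto simp: vec_complex_def vec_eq_iff complex_eq_iff linear_add linear_scale\<close>)

lemma norm_vec_complex: "(norm (vec_complex x y))\<^sup>2 = (norm x)\<^sup>2 + (norm y)\<^sup>2"
  by (simp add: norm_vec_def L2_set_def vec_complex_def sum_nonneg cmod_power2 sum.distrib)

lemma norm_vec_complex_le: "norm (vec_complex x y) \<le> norm x + norm y"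
  by (rule power2_le_imp_le) (auto simp: norm_vec_complex power2_sum)

lemma has_derivative_vec_lambda:
  fixes f :: "'m::finite \<Rightarrow> 'a::real_normed_vector \<Rightarrow> 'b::euclidean_space"
  assumes "\<And>j. (f j has_derivative D j) (at Z)"
  shows "((\<lambda>x. \<chi> j. f j x) has_derivative (\<lambda>V. \<chi> j. D j V)) (at Z)"
  by (subst has_derivative_componentwise_within)
     (auto simp: Basis_vec_def inner_axis intro!: has_derivative_inner_left assms)

lemma has_derivative_vec_complex:
  assumes "(f has_derivative f') (at Z)" "(g has_derivative g') (at Z)"
  shows "((\<lambda>x. vec_complex (f x) (g x)) has_derivative (\<lambda>V. vec_complex (f' V) (g' V))) (at Z)"
proof -
  have "bounded_linear (\<lambda>p::(real^'m)\<times>(real^'m). vec_complex (fst p) (snd p))"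
    unfolding linear_conv_bounded_linear[symmetric] by (intro linear_vec_complex linear_fst linear_snd)
  from bounded_linear.has_derivative[OF this has_derivative_Pair[OF assms]] show ?thesis by simp
qed

lemma cscale_vec_complex:
  "cscale \<i> (vec_complex a b, vec_complex a' b') = (vec_complex (- b) a, vec_complex (- b') a')"
  by (simp add: cscale_def vec_complex_def vec_eq_iff complex_eq_iff)

lemma real_analytic_component:
  fixes g :: "'a::euclidean_space \<Rightarrow> real ^ 'm"
  assumes "real_analytic_on g S" shows "real_analytic_on (\<lambda>x. g x $ j) S"
  unfolding real_analytic_on_def
proof
  fix a assume "a \<in> S"
  then obtain r c where r: "r > 0" and c: "\<forall>x\<in>ball a r.
      ((\<lambda>\<alpha>. (\<Prod>b\<in>Basis. ((x - a) \<bullet> b) ^ \<alpha> b) *\<^sub>R c \<alpha>) has_sum g x) {\<alpha>. \<forall>b. b \<notin> Basis \<longrightarrow> (\<alpha> b = 0)}"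
    using assms unfolding real_analytic_on_def by blast
  show "\<exists>r>0. \<exists>c. \<forall>x\<in>ball a r. ((\<lambda>\<alpha>. (\<Prod>b\<in>Basis. ((x - a) \<bullet> b) ^ \<alpha> b) *\<^sub>R c \<alpha>) has_sum g x $ j)
      {\<alpha>. \<forall>b. b \<notin> Basis \<longrightarrow> (\<alpha> b = 0)}"
  proof (intro exI conjI ballI)
    fix x assume "x \<in> ball a r"
    then show "((\<lambda>\<alpha>. (\<Prod>b\<in>Basis. ((x - a) \<bullet> b) ^ \<alpha> b) *\<^sub>R (c \<alpha> $ j)) has_sum g x $ j)
      {\<alpha>. \<forall>b. b \<notin> Basis \<longrightarrow> (\<alpha> b = 0)}"
      using has_sum_bounded_linear[OF bounded_linear_vec_nth bspec[OF c], of x j] by simp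
  qed (rule r)
qed

lemma vec_complex_0 [simp]: "vec_complex 0 0 = 0"
  by (simp add: vec_complex_def vec_eq_iff complex_eq_iff)

lemma vec_complex_minus: "vec_complex (- a) (- b) = - vec_complex a b"
  by (simp add: vec_complex_def vec_eq_iff complex_eq_iff)

section \<open>A totally real slice of a graph\<close>

text \<open>The points with real \<open>z\<close> form a totally real submanifold of the graph of \<open>\<phi>\<close> of full dimension
\<open>n + d\<close>, parametrized by \<open>(x, s)\<close> in this space.\<close>
type_synonym ('n, 'd) slice_space = "(real ^ 'n) \<times> (real ^ 'd)"

definition slice_emb :: "('n::finite, 'd::finite) slice_space \<Rightarrow> (complex ^ 'n) \<times> (real ^ 'd)" where
  "slice_emb v = (vec_complex (fst v) 0, snd v)"

lemma linear_slice_emb: "linear slice_emb"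
  by (rule linearI) (auto simp: slice_emb_def vec_complex_def vec_eq_iff complex_eq_iff)

lemma slice_emb_0 [simp]: "slice_emb 0 = 0"
  by (rule linear_0[OF linear_slice_emb])

lemma norm_slice_emb [simp]: "norm (slice_emb v) = norm v"
proof -
  have "norm (vec_complex (fst v) 0) = norm (fst v)"
    using norm_vec_complex[of "fst v" 0] by (auto dest: power2_eq_imp_eq)
  then show ?thesis by (cases v) (simp add: slice_emb_def norm_Pair)
qed

text \<open>The function \<open>P j\<close> is the holomorphic extension of the component \<open>\<phi>\<^sub>j\<close> to complex values of all its
real arguments, that is of \<open>Re z\<close>, \<open>Im z\<close> and \<open>Re w\<close>.\<close>
locale complexified_graph =
  fixes \<phi> :: "(complex ^ 'n::finite) \<times> (real ^ 'd::finite) \<Rightarrow> real ^ 'd"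
    and P :: "'d \<Rightarrow> ((complex ^ 'n) \<times> (real ^ 'd)) \<times> ((complex ^ 'n) \<times> (real ^ 'd)) \<Rightarrow> complex"
    and r :: real
  assumes r_pos: "r > 0"
    and P_holo: "holo_on Jc ((*) \<i>) (P j) (ball 0 r)"
    and P_real: "norm a < r \<Longrightarrow> P j (a, 0) = of_real (\<phi> a $ j)"
    and \<phi>_0: "\<phi> 0 = 0"
    and \<phi>_der: "(\<phi> has_derivative (\<lambda>_. 0)) (at 0)"
begin

text \<open>The derivative vanishes on real directions, where \<open>P j\<close> is \<open>\<phi>\<^sub>j\<close>, and therefore, by complex
linearity, on all directions.\<close>
lemma P_der_0: "(P j has_derivative (\<lambda>_. 0)) (at 0)"
proof -
  have "0 \<in> ball 0 r" using r_pos by simp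
  then obtain D where D: "(P j has_derivative D) (at 0)" "\<And>V. D (Jc V) = \<i> * D V"
    using P_holo[of j] unfolding holo_on_def by blast
  have lin: "linear D" using D(1) by (rule has_derivative_linear)
  have z: "((\<lambda>X. (X, 0)) has_derivative (\<lambda>X. (X, 0))) (at (0 :: (complex ^ 'n) \<times> (real ^ 'd)))"
    by (intro has_derivative_Pair has_derivative_ident has_derivative_const)
  have "((\<lambda>X. P j (X, 0)) has_derivative (\<lambda>X. D (X, 0))) (at 0)"
    using diff_chain_at[OF z, of "P j" D] D(1) by (simp add: o_def zero_prod_def)
  moreover have "((\<lambda>X. P j (X, 0)) has_derivative (\<lambda>X. 0)) (at 0)"
  proof (rule has_derivative_transform_within_open[of "\<lambda>X. complex_of_real (\<phi> X $ j)" _ _ UNIV "ball 0 r"])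
    have "((\<lambda>X. complex_of_real (\<phi> X $ j)) has_derivative (\<lambda>X. of_real (0 $ j))) (at 0)"
      by (intro bounded_linear.has_derivative[OF bounded_linear_of_real]
          bounded_linear.has_derivative[OF bounded_linear_vec_nth] \<phi>_der)
    then show "((\<lambda>X. complex_of_real (\<phi> X $ j)) has_derivative (\<lambda>X. 0)) (at 0)" by simp
  qed (use r_pos P_real in auto)
  ultimately have "(\<lambda>X. D (X, 0)) = (\<lambda>X. 0)" by (rule has_derivative_unique)
  then have 1: "D (X, 0) = 0" for X by meson
  have "D (0, X) = 0" for X
    using D(2)[of "(X, 0)"] 1[of X] by (simp add: Jc_def[of "(X, 0)"])
  then have "D V = 0" for V
    using linear_add[OF lin, of "(fst V, 0)" "(0, snd V)"] 1 by simp
  then have "D = (\<lambda>_. 0)" by (rule ext)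
  then show ?thesis using D(1) by simp
qed

lemma P_small_lipschitz:
  assumes "e > 0"
  obtains d where "d > 0" "d \<le> r"
    "\<And>j x y. norm x < d \<Longrightarrow> norm y < d \<Longrightarrow> norm (P j x - P j y) \<le> e * norm (x - y)"
proof -
  have "\<exists>d>0. \<forall>x y. norm x < d \<longrightarrow> norm y < d \<longrightarrow> norm (P j x - P j y) \<le> e * norm (x - y)" for j
  proof -
    obtain d where d: "d > 0" "\<And>x y. x \<in> ball 0 d \<Longrightarrow> y \<in> ball 0 d \<Longrightarrow> norm (P j x - P j y) \<le> e * norm (x - y)"
      by (rule Jc.holo_small_lipschitz[OF P_holo open_ball _ P_der_0 assms]) (use r_pos in auto)
    then show ?thesis by (intro exI[of _ d]) auto
  qed
  then obtain d where d: "\<And>j. d j > 0"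
    "\<And>j x y. norm x < d j \<Longrightarrow> norm y < d j \<Longrightarrow> norm (P j x - P j y) \<le> e * norm (x - y)"
    by metis
  show ?thesis
  proof (rule that[of "min r (Min (range d))"])
    show "0 < min r (Min (range d))" using r_pos d(1) by (auto simp: Min_gr_iff)
  qed (auto intro!: d(2) simp: Min_gr_iff)
qed

lemma \<phi>_continuous: "continuous_on (ball 0 r) \<phi>"
proof -
  have "continuous_on (ball 0 r) (\<lambda>a. P j (a, 0))" for j
    by (rule continuous_on_compose2[OF holo_on_imp_continuous_on[OF P_holo[of j]]])
       (auto intro!: continuous_intros simp: norm_Pair)
  then have "continuous_on (ball 0 r) (\<lambda>a. \<chi> j. Re (P j (a, 0)))"
    by (intro continuous_on_vec_lambda continuous_on_Re)
  then show ?thesis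
    by (rule continuous_on_eq) (simp add: P_real vec_eq_iff)
qed

definition Q :: "'d \<Rightarrow> ('n, 'd) slice_space \<times> ('n, 'd) slice_space \<Rightarrow> complex" where
  "Q j Z = P j (slice_emb (fst Z), slice_emb (snd Z))"

definition reQ where "reQ Z = (\<chi> j. Re (Q j Z))"
definition imQ where "imQ Z = (\<chi> j. Im (Q j Z))"

text \<open>With \<open>\<zeta> = x + \<i>y\<close> and \<open>\<sigma> = s + \<i>t\<close> this is the map \<open>(\<zeta>, \<sigma>) \<mapsto> (\<zeta>, \<sigma> + \<i>Q(\<zeta>, \<sigma>))\<close>, the holomorphic
extension of the parametrization \<open>(x, s) \<mapsto> (x, s + \<i>\<phi>(x, s))\<close> of the slice.\<close>
definition slice :: "('n, 'd) slice_space \<times> ('n, 'd) slice_space \<Rightarrow> ('n, 'd) CC" where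
  "slice Z = (vec_complex (fst (fst Z)) (fst (snd Z)),
     vec_complex (snd (fst Z) - imQ Z) (snd (snd Z) + reQ Z))"

text \<open>The same parametrization extended in the complexification of \<open>\<complex>\<^sup>n \<times> \<complex>\<^sup>d\<close> regarded as a real space:
the pair consists of the formal real and imaginary part. It allows functions that are only real
analytic in the ambient space to be continued from the slice.\<close>
definition slice_parts :: "('n, 'd) slice_space \<times> ('n, 'd) slice_space \<Rightarrow> ('n, 'd) CC \<times> ('n, 'd) CC" where
  "slice_parts Z = ((vec_complex (fst (fst Z)) 0, vec_complex (snd (fst Z)) (reQ Z)),
     (vec_complex (fst (snd Z)) 0, vec_complex (snd (snd Z)) (imQ Z)))"

lemma norm_emb_pair [simp]: "norm (slice_emb X, slice_emb Y) = norm (X, Y)"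
  by (simp add: norm_Pair)

lemma Q_holo: "holo_on Jc ((*) \<i>) (Q j) (ball 0 r)"
  unfolding Q_def
proof (rule holo_on_compose[OF _ P_holo])
  show "holo_on Jc Jc (\<lambda>Z :: ('n, 'd) slice_space \<times> ('n, 'd) slice_space.
      (slice_emb (fst Z), slice_emb (snd Z))) (ball 0 r)"
    unfolding holo_on_def
  proof (intro ballI exI conjI allI)
    have bl: "bounded_linear slice_emb" using linear_slice_emb by (simp add: linear_conv_bounded_linear)
    show "((\<lambda>Z. (slice_emb (fst Z), slice_emb (snd Z))) has_derivative
        (\<lambda>V. (slice_emb (fst V), slice_emb (snd V)))) (at Z)" for Z :: "('n, 'd) slice_space \<times> ('n, 'd) slice_space"
      by (intro has_derivative_Pair bounded_linear.has_derivative[OF bl]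
          has_derivative_fst has_derivative_snd has_derivative_ident)
    show "(slice_emb (fst (Jc V)), slice_emb (snd (Jc V))) = Jc (slice_emb (fst V), slice_emb (snd V))"
      for V :: "('n, 'd) slice_space \<times> ('n, 'd) slice_space"
      using linear_neg[OF linear_slice_emb] by (simp add: Jc_def)
  qed
qed auto

lemma Q_derivatives:
  assumes "norm Z < r"
  obtains D where "\<And>j. (Q j has_derivative D j) (at Z)" "\<And>j V. D j (Jc V) = \<i> * D j V"
    "Z = 0 \<Longrightarrow> \<forall>j V. D j V = 0"
proof -
  have "\<exists>D. (Q j has_derivative D) (at Z) \<and> (\<forall>V. D (Jc V) = \<i> * D V)" for j
    using Q_holo[of j] assms unfolding holo_on_def by simp
  then obtain D where D: "\<And>j. (Q j has_derivative D j) (at Z)" "\<And>j V. D j (Jc V) = \<i> * D j V"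
    by metis
  have "D j V = 0" if "Z = 0" for j V
  proof -
    have bl: "bounded_linear slice_emb" using linear_slice_emb by (simp add: linear_conv_bounded_linear)
    have e: "((\<lambda>Z. (slice_emb (fst Z), slice_emb (snd Z))) has_derivative
        (\<lambda>V. (slice_emb (fst V), slice_emb (snd V)))) (at (0 :: ('n, 'd) slice_space \<times> ('n, 'd) slice_space))"
      by (intro has_derivative_Pair bounded_linear.has_derivative[OF bl]
          has_derivative_fst has_derivative_snd has_derivative_ident)
    have "(Q j has_derivative (\<lambda>V. 0)) (at 0)"
      using diff_chain_at[OF e, of "P j" "\<lambda>_. 0"] P_der_0[of j]
      by (simp add: o_def Q_def[abs_def] flip: zero_prod_def)
    then have "D j = (\<lambda>V. 0)" using D(1)[of j] that has_derivative_unique by blast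
    then show ?thesis by simp
  qed
  with D that show ?thesis by blast
qed

lemma slice_derivative:
  assumes "norm Z < r"
  obtains DR DI where "(reQ has_derivative DR) (at Z)" "(imQ has_derivative DI) (at Z)"
    "\<And>V. DR (Jc V) = - DI V" "\<And>V. DI (Jc V) = DR V"
    "Z = 0 \<Longrightarrow> \<forall>V. DR V = 0 \<and> DI V = 0"
proof -
  obtain D where D: "\<And>j. (Q j has_derivative D j) (at Z)" "\<And>j V. D j (Jc V) = \<i> * D j V"
    "Z = 0 \<Longrightarrow> \<forall>j V. D j V = 0"
    using Q_derivatives[OF assms] by metis
  show ?thesis
  proof (rule that[of "\<lambda>V. \<chi> j. Re (D j V)" "\<lambda>V. \<chi> j. Im (D j V)"])
    show "(reQ has_derivative (\<lambda>V. \<chi> j. Re (D j V))) (at Z)"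
      unfolding reQ_def[abs_def]
      by (intro has_derivative_vec_lambda bounded_linear.has_derivative[OF bounded_linear_Re] D(1))
    show "(imQ has_derivative (\<lambda>V. \<chi> j. Im (D j V))) (at Z)"
      unfolding imQ_def[abs_def]
      by (intro has_derivative_vec_lambda bounded_linear.has_derivative[OF bounded_linear_Im] D(1))
  qed (use D in \<open>auto simp: vec_eq_iff\<close>)
qed

lemma slice_holo: "holo_on Jc (cscale \<i>) slice (ball 0 r)"
  unfolding holo_on_def
proof
  fix Z :: "('n, 'd) slice_space \<times> ('n, 'd) slice_space" assume "Z \<in> ball 0 r"
  then have "norm Z < r" by simp
  then obtain DR DI where D: "(reQ has_derivative DR) (at Z)" "(imQ has_derivative DI) (at Z)"
    "\<And>V. DR (Jc V) = - DI V" "\<And>V. DI (Jc V) = DR V"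
    using slice_derivative by metis
  let ?D = "\<lambda>V. (vec_complex (fst (fst V)) (fst (snd V)), vec_complex (snd (fst V) - DI V) (snd (snd V) + DR V))"
  have "(slice has_derivative ?D) (at Z)"
    unfolding slice_def[abs_def]
    by (intro has_derivative_Pair has_derivative_vec_complex has_derivative_diff has_derivative_add D(1,2)
          has_derivative_fst has_derivative_snd has_derivative_ident)
  moreover have "?D (Jc V) = cscale \<i> (?D V)" for V
    by (simp add: cscale_vec_complex Jc_def[of V] D(3,4)[unfolded Jc_def])
  ultimately show "\<exists>f'. (slice has_derivative f') (at Z) \<and> (\<forall>V. f' (Jc V) = cscale \<i> (f' V))" by blast
qed

lemma slice_parts_holo: "holo_on Jc Jc slice_parts (ball 0 r)"
  unfolding holo_on_def
proof
  fix Z :: "('n, 'd) slice_space \<times> ('n, 'd) slice_space" assume "Z \<in> ball 0 r"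
  then have "norm Z < r" by simp
  then obtain DR DI where D: "(reQ has_derivative DR) (at Z)" "(imQ has_derivative DI) (at Z)"
    "\<And>V. DR (Jc V) = - DI V" "\<And>V. DI (Jc V) = DR V"
    using slice_derivative by metis
  let ?D = "\<lambda>V. ((vec_complex (fst (fst V)) 0, vec_complex (snd (fst V)) (DR V)),
     (vec_complex (fst (snd V)) 0, vec_complex (snd (snd V)) (DI V)))"
  have "(slice_parts has_derivative ?D) (at Z)"
    unfolding slice_parts_def[abs_def]
    by (intro has_derivative_Pair has_derivative_vec_complex D(1,2) has_derivative_const
          has_derivative_fst has_derivative_snd has_derivative_ident)
  moreover have "?D (Jc V) = Jc (?D V)" for V
    using vec_complex_minus[of "fst (snd V)" 0] vec_complex_minus[of "snd (snd V)" "DI V"]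
    by (simp add: Jc_def[of V] Jc_def[of "(_, _)"] D(3,4)[unfolded Jc_def])
  ultimately show "\<exists>f'. (slice_parts has_derivative f') (at Z) \<and> (\<forall>V. f' (Jc V) = Jc (f' V))" by blast
qed

definition real_parts :: "('n, 'd) CC \<Rightarrow> ('n, 'd) slice_space \<times> ('n, 'd) slice_space" where
  "real_parts Z = ((vec_Re (fst Z), vec_Re (snd Z)), (vec_Im (fst Z), vec_Im (snd Z)))"

lemma linear_real_parts: "linear real_parts"
  by (rule linearI) (auto simp: real_parts_def vec_Re_def vec_Im_def vec_eq_iff)

lemma real_parts_cscale: "real_parts (cscale \<i> Z) = Jc (real_parts Z)"
  by (auto simp: real_parts_def vec_Re_def vec_Im_def vec_eq_iff cscale_def Jc_def)

lemma inj_real_parts: "real_parts Z = real_parts Z' \<Longrightarrow> Z = Z'"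
  unfolding real_parts_def by (metis Pair_inject prod.expand vec_complex_simps(3))

lemma real_parts_holo: "holo_on (cscale \<i>) Jc real_parts S"
  unfolding holo_on_def
  using linear_real_parts real_parts_cscale
  by (auto simp: linear_conv_bounded_linear intro!: exI[of _ real_parts] bounded_linear_imp_has_derivative)

text \<open>At the origin \<open>Q\<close> is of second order, so \<open>slice\<close> is tangent to the identity.\<close>
lemma real_parts_slice_derivative_0:
  "((\<lambda>Z. real_parts (slice Z)) has_derivative (\<lambda>V. V)) (at 0)"
proof -
  have "norm (0 :: ('n, 'd) slice_space \<times> ('n, 'd) slice_space) < r" using r_pos by simp
  then obtain DR DI where D: "(reQ has_derivative DR) (at 0)" "(imQ has_derivative DI) (at 0)"
    "\<And>V. DR V = 0" "\<And>V. DI V = 0"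
    using slice_derivative by metis
  have D': "(reQ has_derivative (\<lambda>_. 0)) (at 0)" "(imQ has_derivative (\<lambda>_. 0)) (at 0)"
    using D by (metis ext)+
  have "((\<lambda>Z. ((fst (fst Z), snd (fst Z) - imQ Z), (fst (snd Z), snd (snd Z) + reQ Z))) has_derivative
       (\<lambda>V. ((fst (fst V), snd (fst V) - 0), (fst (snd V), snd (snd V) + 0)))) (at 0)"
    by (intro has_derivative_Pair has_derivative_diff has_derivative_add D'
          has_derivative_fst has_derivative_snd has_derivative_ident)
  then show ?thesis by (simp add: real_parts_def slice_def)
qed

lemma Q_edge: "norm X < r \<Longrightarrow> Q j (X, 0) = of_real (\<phi> (slice_emb X) $ j)"
  using P_real[of "slice_emb X" j] by (simp add: Q_def)

lemma slice_edge:
  assumes "norm X < r"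
  shows "slice (X, 0) = (vec_complex (fst X) 0, vec_complex (snd X) (\<phi> (slice_emb X)))"
    "slice_parts (X, 0) = (slice (X, 0), 0)"
    "graph_defining_function \<phi> (slice (X, 0)) = 0"
proof -
  have q: "reQ (X, 0) = \<phi> (slice_emb X)" "imQ (X, 0) = 0"
    using Q_edge[OF assms] by (auto simp: reQ_def imQ_def vec_eq_iff)
  show *: "slice (X, 0) = (vec_complex (fst X) 0, vec_complex (snd X) (\<phi> (slice_emb X)))"
    by (simp add: slice_def q)
  then show "slice_parts (X, 0) = (slice (X, 0), 0)"
    by (simp add: slice_parts_def slice_def q flip: zero_prod_def)
  show "graph_defining_function \<phi> (slice (X, 0)) = 0"
    by (simp add: * graph_defining_function_def slice_emb_def)
qed

lemma slice_0: "slice 0 = 0" "slice_parts 0 = 0"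
proof -
  show *: "slice 0 = 0"
    using slice_edge(1)[of 0] r_pos \<phi>_0 by (simp flip: zero_prod_def)
  show "slice_parts 0 = 0"
    using slice_edge(2)[of 0] r_pos * by (simp flip: zero_prod_def)
qed

end

section \<open>The slice map and the wedge\<close>
lemma norm_vec_le_of_components:
  fixes v :: "real ^ 'm::finite"
  assumes "\<And>j. \<bar>v $ j\<bar> \<le> B" shows "norm v \<le> real CARD('m) * B"
proof -
  have "norm v \<le> (\<Sum>j\<in>UNIV. \<bar>v $ j\<bar>)" by (rule norm_le_l1_cart)
  also have "\<dots> \<le> (\<Sum>j\<in>(UNIV::'m set). B)" by (intro sum_mono assms)
  finally show ?thesis by simp
qed

lemma complexified_graph_exists:
  fixes \<phi> :: "(complex ^ 'n::finite) \<times> (real ^ 'd::finite) \<Rightarrow> real ^ 'd"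
  assumes "real_analytic_on \<phi> S" "0 \<in> S" "\<phi> 0 = 0" "(\<phi> has_derivative (\<lambda>_. 0)) (at 0)"
  obtains P r where "complexified_graph \<phi> P r"
proof -
  have "\<exists>r P. r > 0 \<and> holo_on Jc ((*) \<i>) P (ball 0 r) \<and>
      (\<forall>a. norm a < r \<longrightarrow> P (a, 0) = complex_of_real (\<phi> a $ j))" for j
    by (rule real_analytic_complexify[OF real_analytic_component[OF assms(1)] assms(2), of j]) auto
  then obtain r P where rP: "\<And>j. r j > 0" "\<And>j. holo_on Jc ((*) \<i>) (P j) (ball 0 (r j))"
    "\<And>j a. norm a < r j \<Longrightarrow> P j (a, 0) = complex_of_real (\<phi> a $ j)"
    by metis
  have le: "Min (range r) \<le> r j" for j by simp
  have "complexified_graph \<phi> P (Min (range r))"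
  proof
    show "Min (range r) > 0" using rP(1) by (auto simp: Min_gr_iff)
    show "holo_on Jc ((*) \<i>) (P j) (ball 0 (Min (range r)))" for j
      by (rule holo_on_subset[OF rP(2)]) (use le in \<open>auto intro: less_le_trans\<close>)
    show "P j (a, 0) = complex_of_real (\<phi> a $ j)" if "norm a < Min (range r)" for a j
      using rP(3) that le less_le_trans by blast
  qed (use assms in auto)
  then show ?thesis by (rule that)
qed

text \<open>A linear isomorphism that takes the orthant into an arbitrarily narrow cone around \<open>y0\<close>, of the form
\<open>v \<mapsto> a (e' v + (v \<bullet> One) y0)\<close>. On the orthant \<open>norm v \<le> v \<bullet> One\<close>, so the first term is a small
perturbation of the second. It is injective unless \<open>e' = - (y0 \<bullet> One)\<close>, which leaves enough choices
for \<open>e'\<close>; the factor \<open>a\<close> makes the image of a cube as small as required.\<close>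
lemma cone_map:
  fixes y0 :: "'a::euclidean_space"
  assumes e: "e > 0" and d: "d > 0"
  obtains S :: "'a \<Rightarrow> 'a" where "linear S" "inj S"
    "\<And>v. (\<And>b. b \<in> Basis \<Longrightarrow> \<bar>v \<bullet> b\<bar> < R) \<Longrightarrow> norm (S v) < d"
    "\<And>v. (\<And>b. b \<in> Basis \<Longrightarrow> v \<bullet> b > 0) \<Longrightarrow> \<exists>t>0. norm (S v - t *\<^sub>R y0) \<le> e * t"
proof -
  obtain e' where e': "e' > 0" "e' \<le> e" "e' + y0 \<bullet> One \<noteq> 0"
    using e by (cases "e + y0 \<bullet> One = 0") (auto intro: that[of e] that[of "e/2"])
  define N where "N = real DIM('a) * \<bar>R\<bar>"
  define K where "K = e' * N + N * norm (One :: 'a) * norm y0 + 1"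
  have N: "N \<ge> 0" by (simp add: N_def)
  have K: "K > 0" using e' N by (simp add: K_def add_nonneg_pos)
  define a where "a = d / K"
  have a: "a > 0" using d K by (simp add: a_def)
  define S where "S = (\<lambda>v::'a. a *\<^sub>R (e' *\<^sub>R v + (v \<bullet> One) *\<^sub>R y0))"
  have lin: "linear S"
    by (rule linearI) (simp_all add: S_def inner_add_left algebra_simps)
  show ?thesis
  proof (rule that[of S])
    show "linear S" by (rule lin)
    show "inj S"
      unfolding linear_injective_0[OF lin]
    proof (intro allI impI)
      fix v assume "S v = 0"
      then have z: "e' *\<^sub>R v + (v \<bullet> One) *\<^sub>R y0 = 0" using a by (simp add: S_def)
      then have "(e' *\<^sub>R v + (v \<bullet> One) *\<^sub>R y0) \<bullet> One = 0" by simp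
      then have "(v \<bullet> One) * (e' + y0 \<bullet> One) = 0" by (simp add: inner_add_left algebra_simps)
      then have "v \<bullet> One = 0" using e' by simp
      then show "v = 0" using z e' by simp
    qed
    fix v :: 'a
    show "norm (S v) < d" if v: "\<And>b. b \<in> Basis \<Longrightarrow> \<bar>v \<bullet> b\<bar> < R"
    proof -
      have "norm v \<le> (\<Sum>b\<in>Basis. \<bar>v \<bullet> b\<bar>)" by (rule norm_le_l1)
      also have "\<dots> \<le> (\<Sum>b\<in>(Basis::'a set). \<bar>R\<bar>)" by (intro sum_mono) (use v in force)
      finally have nv: "norm v \<le> N" by (simp add: N_def)
      have "\<bar>v \<bullet> One\<bar> \<le> norm v * norm (One :: 'a)" by (rule Cauchy_Schwarz_ineq2)
      also have "\<dots> \<le> N * norm (One :: 'a)" by (intro mult_right_mono nv) auto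
      finally have "\<bar>v \<bullet> One\<bar> * norm y0 \<le> N * norm (One :: 'a) * norm y0"
        by (rule mult_right_mono) auto
      moreover have "e' * norm v \<le> e' * N" using nv e' by simp
      moreover have "norm (e' *\<^sub>R v + (v \<bullet> One) *\<^sub>R y0) \<le> e' * norm v + \<bar>v \<bullet> One\<bar> * norm y0"
        using norm_triangle_ineq[of "e' *\<^sub>R v" "(v \<bullet> One) *\<^sub>R y0"] e' by simp
      ultimately have "norm (e' *\<^sub>R v + (v \<bullet> One) *\<^sub>R y0) < K" unfolding K_def by linarith
      then have "a * norm (e' *\<^sub>R v + (v \<bullet> One) *\<^sub>R y0) < a * K" using a by simp
      then show ?thesis using a K d by (simp add: S_def a_def)
    qed
    show "\<exists>t>0. norm (S v - t *\<^sub>R y0) \<le> e * t" if v: "\<And>b. b \<in> Basis \<Longrightarrow> v \<bullet> b > 0"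
    proof (intro exI conjI)
      have s: "v \<bullet> One = (\<Sum>b\<in>Basis. v \<bullet> b)" by (simp add: inner_sum_right)
      then have pos: "v \<bullet> One > 0" using v by (simp add: sum_pos)
      then show "a * (v \<bullet> One) > 0" using a by simp
      have "norm v \<le> (\<Sum>b\<in>Basis. \<bar>v \<bullet> b\<bar>)" by (rule norm_le_l1)
      also have "\<dots> = v \<bullet> One" unfolding s by (intro sum.cong) (use v in \<open>auto simp: less_imp_le\<close>)
      finally have "e' * norm v \<le> e * (v \<bullet> One)" using e' pos by (intro mult_mono) auto
      then have "a * (e' * norm v) \<le> a * (e * (v \<bullet> One))" using a by simp
      moreover have "S v - (a * (v \<bullet> One)) *\<^sub>R y0 = (a * e') *\<^sub>R v" by (simp add: S_def algebra_simps)
      ultimately show "norm (S v - (a * (v \<bullet> One)) *\<^sub>R y0) \<le> e * (a * (v \<bullet> One))"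
        using a e' by (simp add: algebra_simps)
    qed
  qed
qed

context complexified_graph
begin

text \<open>In the coordinates of the slice map the defining function is the imaginary part \<open>t\<close> of \<open>\<sigma>\<close> up to
an error that vanishes on the slice and grows slowly away from it, because the functions \<open>P j\<close> have
small Lipschitz constants near the origin. Near the origin a wedge of
the graph therefore contains the image of a flat wedge whose directions \<open>(y, t)\<close> are close to
\<open>(0, y0)\<close> with \<open>y0\<close> in the cone.\<close>
lemma graph_slice_error:
  assumes k: "k > 0"
  obtains d where "d > 0" "d \<le> r"
    "\<And>Z. norm Z < d \<Longrightarrow>
       norm (graph_defining_function \<phi> (slice Z) - snd (snd Z)) \<le> k * norm (snd Z)"
proof -
  define N where "N = real CARD('d)"
  have N: "N \<ge> 1" by (simp add: N_def)
  define e where "e = min 1 (k / (N * (2 + N)))"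
  have e: "e > 0" "e \<le> 1" using k N by (auto simp: e_def)
  have ke: "N * (e * (2 + N)) \<le> k"
  proof -
    have "e \<le> k / (N * (2 + N))" by (simp add: e_def)
    moreover have "N * (2 + N) > 0" using N by simp
    ultimately have "e * (N * (2 + N)) \<le> k" by (simp only: pos_le_divide_eq)
    then show ?thesis by (simp only: mult.left_commute)
  qed
  obtain d where d: "d > 0" "d \<le> r"
    "\<And>j x y. norm x < d \<Longrightarrow> norm y < d \<Longrightarrow> norm (P j x - P j y) \<le> e * norm (x - y)"
    using P_small_lipschitz[OF e(1)] by blast
  define d' where "d' = d / (4 + N)"
  have d': "d' > 0" "(4 + N) * d' = d" using d N by (auto simp: d'_def)
  have "d' * 1 \<le> d' * (4 + N)" using d'(1) N by (intro mult_left_mono) auto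
  then have d'd: "d' \<le> d" using d'(2) by (simp add: mult.commute)
  show ?thesis
  proof (rule that[of d'])
    show "d' > 0" "d' \<le> r" using d' d'd d by auto
    fix Z :: "('n, 'd) slice_space \<times> ('n, 'd) slice_space" assume Z: "norm Z < d'"
    obtain X Y where XY: "Z = (X, Y)" by (cases Z)
    have nX: "norm X \<le> norm Z" and nY: "norm Y \<le> norm Z"
      using XY norm_fst_le[of X Y] norm_snd_le[of Y X] by auto
    have nXd: "norm X < d" using nX Z d'd by simp
    have Qdiff: "norm (Q j Z - of_real (\<phi> (slice_emb X) $ j)) \<le> e * norm Y" for j
    proof -
      have "norm (P j (slice_emb X, slice_emb Y) - P j (slice_emb X, 0)) \<le>
          e * norm ((slice_emb X, slice_emb Y) - (slice_emb X, 0))"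
        by (rule d(3)) (use Z XY d'd nXd in \<open>auto simp: norm_Pair[of _ 0]\<close>)
      moreover have "(slice_emb X, slice_emb Y) - (slice_emb X, 0) = (0, slice_emb Y)" by simp
      moreover have "P j (slice_emb X, 0) = of_real (\<phi> (slice_emb X) $ j)"
        using Q_edge[of X j] nXd d(2) by (simp add: Q_def)
      ultimately show ?thesis by (simp add: Q_def XY norm_Pair)
    qed
    have imQ: "norm (imQ Z) \<le> N * norm Y"
      unfolding N_def
    proof (rule norm_vec_le_of_components)
      fix j
      have "\<bar>imQ Z $ j\<bar> = \<bar>Im (Q j Z - of_real (\<phi> (slice_emb X) $ j))\<bar>" by (simp add: imQ_def)
      also have "\<dots> \<le> e * norm Y" using Qdiff abs_Im_le_cmod order_trans by blast
      also have "\<dots> \<le> 1 * norm Y" using e by (intro mult_right_mono) auto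
      finally show "\<bar>imQ Z $ j\<bar> \<le> norm Y" by simp
    qed
    define b where "b = (vec_complex (fst X) (fst Y), snd X - imQ Z)"
    have bX: "norm (b - slice_emb X) \<le> (1 + N) * norm Y"
    proof -
      have "b - slice_emb X = (vec_complex 0 (fst Y), - imQ Z)"
        by (auto simp: b_def slice_emb_def vec_complex_def vec_eq_iff complex_eq_iff)
      then have "norm (b - slice_emb X) \<le> norm (vec_complex 0 (fst Y)) + norm (imQ Z)"
        using norm_Pair_le[of "vec_complex 0 (fst Y)" "- imQ Z"] by simp
      moreover have "norm (vec_complex 0 (fst Y)) \<le> norm Y"
        using norm_vec_complex_le[of 0 "fst Y"] norm_fst_le[of "fst Y" "snd Y"] by (simp add: order_trans)
      ultimately show ?thesis using imQ by (simp add: algebra_simps)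
    qed
    have "norm b < d"
    proof -
      have "norm b \<le> norm (slice_emb X) + norm (b - slice_emb X)" by (metis norm_triangle_sub)
      also have "\<dots> \<le> norm Z + (1 + N) * norm Z"
        unfolding norm_slice_emb
        using order_trans[OF bX mult_left_mono[OF nY]] nX N by (intro add_mono) auto
      also have "\<dots> = (2 + N) * norm Z" by (simp add: algebra_simps)
      also have "\<dots> \<le> (4 + N) * norm Z" by (intro mult_right_mono) auto
      also have "\<dots> < (4 + N) * d'" using Z N by (intro mult_strict_left_mono) auto
      finally show ?thesis using d' by simp
    qed
    have phidiff: "\<bar>\<phi> b $ j - \<phi> (slice_emb X) $ j\<bar> \<le> e * ((1 + N) * norm Y)" for j
    proof -
      have "norm (P j (b, 0) - P j (slice_emb X, 0)) \<le> e * norm ((b, 0 :: (complex ^ 'n) \<times> (real ^ 'd)) - (slice_emb X, 0))"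
        by (rule d(3)) (use \<open>norm b < d\<close> nXd in \<open>auto simp: norm_Pair\<close>)
      also have "\<dots> = e * norm (b - slice_emb X)" by (simp add: norm_Pair)
      also have "\<dots> \<le> e * ((1 + N) * norm Y)" using bX e by simp
      finally have "norm (P j (b, 0) - P j (slice_emb X, 0)) \<le> e * ((1 + N) * norm Y)" .
      moreover have "P j (b, 0) - P j (slice_emb X, 0) = of_real (\<phi> b $ j - \<phi> (slice_emb X) $ j)"
        using P_real[of b j] P_real[of "slice_emb X" j] \<open>norm b < d\<close> nXd d(2) by simp
      ultimately show ?thesis by (simp only: norm_of_real)
    qed
    let ?v = "graph_defining_function \<phi> (slice Z) - snd (snd Z)"
    have "norm ?v \<le> N * (e * (2 + N) * norm Y)"
      unfolding N_def
    proof (rule norm_vec_le_of_components)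
      fix j
      have "?v $ j = Re (Q j Z - of_real (\<phi> (slice_emb X) $ j)) - (\<phi> b $ j - \<phi> (slice_emb X) $ j)"
        by (simp add: graph_defining_function_def slice_def b_def XY reQ_def)
      then have "\<bar>?v $ j\<bar> \<le> \<bar>Re (Q j Z - of_real (\<phi> (slice_emb X) $ j))\<bar> + \<bar>\<phi> b $ j - \<phi> (slice_emb X) $ j\<bar>"
        by (simp only: abs_triangle_ineq4)
      also have "\<dots> \<le> e * norm Y + e * ((1 + N) * norm Y)"
        using Qdiff[of j] abs_Re_le_cmod[of "Q j Z - of_real (\<phi> (slice_emb X) $ j)"] phidiff[of j] by linarith
      also have "\<dots> = e * (2 + N) * norm Y" by (simp add: algebra_simps)
      finally show "\<bar>?v $ j\<bar> \<le> e * (2 + real CARD('d)) * norm Y" by (simp add: N_def)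
    qed
    also have "\<dots> = N * (e * (2 + N)) * norm Y" by (simp add: algebra_simps)
    also have "\<dots> \<le> k * norm Y" using ke by (intro mult_right_mono) auto
    finally show "norm ?v \<le> k * norm (snd Z)" by (simp add: XY)
  qed
qed

text \<open>In the coordinates \<open>z\<close>, \<open>Re w\<close> and \<open>\<rho>\<close> the neighbourhoods can be taken as products of balls, and the
wedge becomes the product of a ball with the convex set \<open>\<Gamma> \<inter> ball 0 d'\<close>.\<close>
lemma wedge_neighbourhood:
  assumes \<Gamma>: "open \<Gamma>" "convex \<Gamma>" and N: "open N" "0 \<in> N"
  obtains \<Omega>' where "open \<Omega>'" "0 \<in> \<Omega>'" "\<Omega>' \<subseteq> N"
    "open {Z \<in> \<Omega>'. graph_defining_function \<phi> Z \<in> \<Gamma>}"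
    "connected {Z \<in> \<Omega>'. graph_defining_function \<phi> Z \<in> \<Gamma>}"
proof -
  let ?\<rho> = "graph_defining_function \<phi>"
  define \<psi> where "\<psi> = (\<lambda>p. (fst (fst p), vec_complex (snd (fst p)) (snd p + \<phi> (fst p))))"
  define p where "p = (\<lambda>Z::('n, 'd) CC. (fst Z, vec_Re (snd Z)))"
  have cvc: "continuous_on A (\<lambda>x. vec_complex (f x) (g x))"
    if "continuous_on A f" "continuous_on A g" for A :: "'z::topological_space set" and f g :: "'z \<Rightarrow> real ^ 'd"
    unfolding vec_complex_def Complex_eq using that by (intro continuous_intros)
  have cre: "continuous_on A (\<lambda>x. vec_Re (snd x))" "continuous_on A (\<lambda>x. vec_Im (snd x))" for A :: "('n, 'd) CC set"
    unfolding vec_Re_def vec_Im_def by (intro continuous_intros)+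
  have \<psi>_cont: "continuous_on (ball 0 r \<times> UNIV) \<psi>"
    unfolding \<psi>_def
    by (intro continuous_intros cvc continuous_on_compose2[OF \<phi>_continuous]) auto
  have p_cont: "continuous_on A p" for A unfolding p_def by (intro continuous_intros cre)
  have \<psi>_0: "\<psi> 0 = 0" using \<phi>_0 by (simp add: \<psi>_def flip: zero_prod_def)
  have "open (ball 0 r \<times> UNIV \<inter> \<psi> -` N)"
    by (rule continuous_open_preimage[OF \<psi>_cont _ N(1)]) (auto intro: open_Times)
  moreover have "0 \<in> ball 0 r \<times> UNIV \<inter> \<psi> -` N"
    using \<psi>_0 N r_pos by (simp add: mem_Times_iff)
  ultimately obtain A B where "open A" "open B" "0 \<in> A \<times> B"
      "A \<times> B \<subseteq> ball 0 r \<times> UNIV \<inter> \<psi> -` N"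
    by (rule open_prod_elim)
  then have AB: "open A" "open B" "0 \<in> A" "0 \<in> B" "A \<times> B \<subseteq> ball 0 r \<times> UNIV \<inter> \<psi> -` N"
    by (simp_all add: mem_Times_iff)
  obtain d where d: "d > 0" "ball 0 d \<subseteq> A" using AB open_contains_ball by blast
  obtain d' where d': "d' > 0" "ball 0 d' \<subseteq> B" using AB open_contains_ball by blast
  have sub: "\<psi> (a, y) \<in> N" "a \<in> ball 0 r" if "a \<in> ball 0 d" "y \<in> ball 0 d'" for a y
    using that d d' AB(5) by blast+
  define \<Omega>' where "\<Omega>' = {Z. p Z \<in> ball 0 d \<and> ?\<rho> Z \<in> ball 0 d'}"
  have p\<psi>: "p (\<psi> q) = fst q" "?\<rho> (\<psi> q) = snd q" for q
    by (auto simp: p_def \<psi>_def graph_defining_function_def)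
  have \<psi>p: "\<psi> (p Z, ?\<rho> Z) = Z" for Z
    by (cases Z) (simp add: p_def \<psi>_def graph_defining_function_def)
  have dr: "ball (0 :: (complex ^ 'n) \<times> (real ^ 'd)) d \<subseteq> ball 0 r" 
  proof
    fix a :: "(complex ^ 'n) \<times> (real ^ 'd)" assume "a \<in> ball 0 d"
    then show "a \<in> ball 0 r" by (rule sub(2)[of _ 0]) (use d'(1) in simp)
  qed
  have openU: "open {Z. p Z \<in> ball 0 d}"
    using open_vimage[OF open_ball p_cont[of UNIV], of 0 d] by (simp add: vimage_def)
  have \<rho>_cont: "continuous_on {Z. p Z \<in> ball 0 d} ?\<rho>"
  proof -
    have "continuous_on {Z. p Z \<in> ball 0 d} (\<lambda>Z. vec_Im (snd Z) - \<phi> (p Z))"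
      by (intro continuous_on_diff cre continuous_on_compose2[OF \<phi>_continuous p_cont]) (use dr in auto)
    then show ?thesis
      by (rule continuous_on_eq) (auto simp: graph_defining_function_def p_def split_beta)
  qed
  have opn: "open {Z. p Z \<in> ball 0 d \<and> ?\<rho> Z \<in> V}" if "open V" for V
  proof -
    have "{Z. p Z \<in> ball 0 d \<and> ?\<rho> Z \<in> V} = {Z. p Z \<in> ball 0 d} \<inter> ?\<rho> -` V" by blast
    then show ?thesis using continuous_open_preimage[OF \<rho>_cont openU that] by simp
  qed
  have W: "{Z \<in> \<Omega>'. ?\<rho> Z \<in> \<Gamma>} = {Z. p Z \<in> ball 0 d \<and> ?\<rho> Z \<in> ball 0 d' \<inter> \<Gamma>}"
    by (auto simp: \<Omega>'_def)
  show ?thesis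
  proof (rule that[of \<Omega>'])
    show "open \<Omega>'" unfolding \<Omega>'_def by (rule opn) simp
    show "open {Z \<in> \<Omega>'. ?\<rho> Z \<in> \<Gamma>}" unfolding W by (intro opn open_Int open_ball \<Gamma>)
    have "0 = \<psi> (0, 0)" using \<psi>_0 by (simp add: zero_prod_def)
    then show "0 \<in> \<Omega>'" using p\<psi>[of "(0, 0)"] d d' by (simp add: \<Omega>'_def)
    show "\<Omega>' \<subseteq> N"
    proof
      fix Z assume "Z \<in> \<Omega>'"
      then show "Z \<in> N" using sub(1)[of "p Z" "?\<rho> Z"] by (simp add: \<Omega>'_def \<psi>p)
    qed
    have "{Z. p Z \<in> ball 0 d \<and> ?\<rho> Z \<in> ball 0 d' \<inter> \<Gamma>} = \<psi> ` (ball 0 d \<times> (ball 0 d' \<inter> \<Gamma>))"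
    proof (intro equalityI subsetI)
      fix Z assume "Z \<in> {Z. p Z \<in> ball 0 d \<and> ?\<rho> Z \<in> ball 0 d' \<inter> \<Gamma>}"
      then have "(p Z, ?\<rho> Z) \<in> ball 0 d \<times> (ball 0 d' \<inter> \<Gamma>)" by simp
      then show "Z \<in> \<psi> ` (ball 0 d \<times> (ball 0 d' \<inter> \<Gamma>))" by (metis \<psi>p image_eqI)
    qed (auto simp: p\<psi>)
    moreover have "connected (\<psi> ` (ball 0 d \<times> (ball 0 d' \<inter> \<Gamma>)))"
      using dr by (intro connected_continuous_image continuous_on_subset[OF \<psi>_cont] convex_connected
          convex_Times convex_Int convex_ball \<Gamma>) auto
    ultimately show "connected {Z \<in> \<Omega>'. ?\<rho> Z \<in> \<Gamma>}" unfolding W by simp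
  qed
qed

end

section \<open>Holomorphic extension from a wedge\<close>
theorem theorem2p6:
  fixes M \<Omega> W :: "('n::finite, 'd::finite) CC set"
    and \<phi> :: "(complex ^ 'n) \<times> (real ^ 'd) \<Rightarrow> real ^ 'd"
    and \<rho> :: "('n, 'd) CC \<Rightarrow> real ^ 'd"
    and \<Gamma> :: "(real ^ 'd) set"
    and f f_ext :: "('n, 'd) CC \<Rightarrow> complex"
  assumes "generic_real_analytic_submanifold M"
    and "0 \<in> M"
    and "regular_coordinates M \<Omega> \<phi>"
    and "\<rho> = graph_defining_function \<phi>"
    and "open_convex_cone \<Gamma>"
    and "W = wedge \<Omega> \<rho> \<Gamma>"
    and "holomorphic_CC_on f W"
    and "continuous_on (W \<union> (M \<inter> \<Omega>)) f_ext"
    and "\<forall>Z\<in>W. f_ext Z = f Z"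
    and "real_analytic_along (\<lambda>Z. Im (f_ext Z)) (M \<inter> \<Omega>)"
  shows "\<exists>\<Omega>' F. open \<Omega>' \<and> 0 \<in> \<Omega>' \<and> holomorphic_CC_on F \<Omega>' \<and> (\<forall>Z\<in>W \<inter> \<Omega>'. F Z = f Z)"
proof (cases "\<Gamma> = {}")
  case True
  then have "W = {}" using assms(6) by (auto simp: wedge_def)
  moreover have "holomorphic_CC_on (\<lambda>_. 0) UNIV"
    unfolding holomorphic_CC_on_iff[OF open_UNIV] by (rule holo_on_const)
  ultimately show ?thesis by (intro exI[of _ UNIV] exI[of _ "\<lambda>_. 0"]) auto
next
  case False
  have reg: "open \<Omega>" "0 \<in> \<Omega>" "real_analytic_on \<phi> ((\<lambda>(z, w). (z, vec_Re w)) ` \<Omega>)"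
    "\<phi> (0, 0) = 0" "(\<phi> has_derivative (\<lambda>_. 0)) (at (0, 0))" "M \<inter> \<Omega> = {Z\<in>\<Omega>. \<rho> Z = 0}"
    using assms(3,4) by (auto simp: regular_coordinates_def)
  have "vec_Re 0 = (0 :: real ^ 'd)" by (simp add: vec_Re_def vec_eq_iff)
  then have "0 \<in> (\<lambda>(z, w). (z, vec_Re w)) ` \<Omega>"
    using reg(2) by (intro image_eqI[of _ _ 0]) (auto simp: zero_prod_def)
  then obtain P r where "complexified_graph \<phi> P r"
    using complexified_graph_exists[OF reg(3)] reg(4,5) by (auto simp flip: zero_prod_def)
  then interpret complexified_graph \<phi> P r .
  have \<Gamma>: "open \<Gamma>" "convex \<Gamma>" "\<And>y t. y \<in> \<Gamma> \<Longrightarrow> t > 0 \<Longrightarrow> t *\<^sub>R y \<in> \<Gamma>"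
    using assms(5) by (auto simp: open_convex_cone_def)
  obtain y0 where "y0 \<in> \<Gamma>" using False by blast
  then obtain e where e: "e > 0" "ball y0 e \<subseteq> \<Gamma>" using \<Gamma>(1) open_contains_ball by blast

  have "0 \<in> M \<inter> \<Omega>" using assms(2) reg(2) by simp
  from bspec[OF assms(10)[unfolded real_analytic_along_def] this]
  obtain U G where UG: "open U" "0 \<in> U" "real_analytic_on G U"
    "\<forall>x\<in>M \<inter> \<Omega> \<inter> U. G x = Im (f_ext x)"
    by (elim exE conjE)
  obtain rG GC where GC: "rG > 0" "holo_on Jc ((*) \<i>) GC (ball 0 rG)"
    "\<And>X. norm X < rG \<Longrightarrow> GC (X, 0) = complex_of_real (G (0 + X))"
    by (rule real_analytic_complexify[OF UG(3,2)]) (rule that)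

  obtain \<Omega>1 where \<Omega>1: "open \<Omega>1" "0 \<in> \<Omega>1" "\<Omega>1 \<subseteq> \<Omega> \<inter> U"
    "open {Z \<in> \<Omega>1. graph_defining_function \<phi> Z \<in> \<Gamma>}"
    using wedge_neighbourhood[OF \<Gamma>(1,2), of "\<Omega> \<inter> U"] reg(1,2) UG(1,2) by blast
  have W1: "W \<inter> \<Omega>1 = {Z \<in> \<Omega>1. graph_defining_function \<phi> Z \<in> \<Gamma>}"
    using \<Omega>1(3) assms(4,6) by (auto simp: wedge_def)
  then have openW1: "open (W \<inter> \<Omega>1)" using \<Omega>1(4) by simp
  have "holomorphic_CC_on f (W \<inter> \<Omega>1)"
    using assms(7) unfolding holomorphic_CC_on_def by (meson IntD1 Int_lower1 has_derivative_subset)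
  then have f_holo: "holo_on (cscale \<i>) ((*) \<i>) f (W \<inter> \<Omega>1)"
    using holomorphic_CC_on_iff[OF openW1] by simp

  \<comment> \<open>Relative to the scale \<open>t\<close> of a point, the errors \<open>e/2\<close> from the linear map and \<open>e/4\<close> from \<open>k\<close> add up to less than \<open>e\<close>.\<close>
  define k where "k = e / (4 * (e + norm y0 + 1))"
  have k: "k > 0" using e by (simp add: k_def add_pos_nonneg)
  obtain d1 where d1: "d1 > 0" "d1 \<le> r" "\<And>Z. norm Z < d1 \<Longrightarrow>
       norm (graph_defining_function \<phi> (slice Z) - snd (snd Z)) \<le> k * norm (snd Z)"
    using graph_slice_error[OF k] by blast
  have "open (ball 0 r \<inter> slice -` \<Omega>1)" "open (ball 0 r \<inter> slice_parts -` ball 0 rG)"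
    using \<Omega>1(1) by (auto intro!: continuous_open_preimage holo_on_imp_continuous_on[OF slice_holo]
        holo_on_imp_continuous_on[OF slice_parts_holo])
  then have "open (ball 0 d1 \<inter> (ball 0 r \<inter> slice -` \<Omega>1) \<inter> (ball 0 r \<inter> slice_parts -` ball 0 rG))"
    by blast
  moreover have "0 \<in> ball 0 d1 \<inter> (ball 0 r \<inter> slice -` \<Omega>1) \<inter> (ball 0 r \<inter> slice_parts -` ball 0 rG)"
    using d1(1) r_pos slice_0 \<Omega>1(2) GC(1) by simp
  ultimately obtain d where d: "d > 0"
    "ball 0 d \<subseteq> ball 0 d1 \<inter> (ball 0 r \<inter> slice -` \<Omega>1) \<inter> (ball 0 r \<inter> slice_parts -` ball 0 rG)"
    using open_contains_ball by blast
  have small: "norm Z < d1" "norm Z < r" "slice Z \<in> \<Omega>1" "slice_parts Z \<in> ball 0 rG"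
    if "Z \<in> ball 0 d" for Z
    using subsetD[OF d(2) that] by auto

  obtain S :: "('n, 'd) slice_space \<Rightarrow> ('n, 'd) slice_space" where S: "linear S" "inj S"
    "\<And>v. (\<And>b. b \<in> Basis \<Longrightarrow> \<bar>v \<bullet> b\<bar> < 6) \<Longrightarrow> norm (S v) < d / 2"
    "\<And>v. (\<And>b. b \<in> Basis \<Longrightarrow> v \<bullet> b > 0) \<Longrightarrow> \<exists>t>0. norm (S v - t *\<^sub>R (0, y0)) \<le> e / 2 * t"
    by (rule cone_map[of "e / 2" "d / 2" 6 "(0, y0)"]) (use e(1) d(1) in auto)
  \<comment> \<open>The linear coordinates in which the wedge around \<open>(0, y0)\<close> contains the orthant.\<close>
  define T where "T = (\<lambda>Z. (S (fst Z), S (snd Z)))"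
  have T_der: "(T has_derivative T) (at Z)" for Z
  proof -
    have bl: "bounded_linear S" using S(1) by (simp add: linear_conv_bounded_linear)
    show ?thesis
      unfolding T_def by (intro has_derivative_Pair bounded_linear.has_derivative[OF bl]
          has_derivative_fst has_derivative_snd has_derivative_ident)
  qed
  have T_Jc: "T (Jc V) = Jc (T V)" for V
    using linear_neg[OF S(1)] by (simp add: T_def Jc_def)
  have T_holo: "holo_on Jc Jc T A" for A
    unfolding holo_on_def using T_der T_Jc by blast
  have T_inj: "inj T"
    by (rule injI) (simp add: T_def inj_eq[OF S(2)] prod_eqI)
  have T_0: "T 0 = 0" using linear_0[OF S(1)] by (simp add: T_def flip: zero_prod_def)
  have T_ball: "T Z \<in> ball 0 d" if "Z \<in> polydisc 6" for Z
  proof -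
    have "\<bar>fst Z \<bullet> b\<bar> < 6" "\<bar>snd Z \<bullet> b\<bar> < 6" if "b \<in> Basis" for b
      using \<open>Z \<in> polydisc 6\<close> that abs_Re_le_cmod[of "ccoord Z b"] abs_Im_le_cmod[of "ccoord Z b"]
      by (auto simp: polydisc_def ccoord_def intro: le_less_trans)
    then have "norm (S (fst Z)) < d / 2" "norm (S (snd Z)) < d / 2" using S(3) by blast+
    then show ?thesis
      using norm_Pair_le[of "S (fst Z)" "S (snd Z)"] by (simp add: T_def)
  qed
  define H where "H = (\<lambda>Z. slice (T Z))"
  have T_sub: "T ` polydisc 6 \<subseteq> ball 0 r"
    by (rule image_subsetI) (simp add: small(2)[OF T_ball])
  have H_holo: "holo_on Jc (cscale \<i>) H (polydisc 6)"
    unfolding H_def by (rule holo_on_compose[OF T_holo slice_holo T_sub])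
  have H_\<Omega>1: "H Z \<in> \<Omega>1" if "Z \<in> polydisc 6" for Z
    using small(3) T_ball[OF that] by (simp add: H_def)
  have H_edge: "H Z \<in> M \<inter> \<Omega>" "slice_parts (T Z) = (H Z, 0)" if Z: "Z \<in> polydisc 6 \<inter> real_edge" for Z
  proof -
    have TZ: "T Z = (S (fst Z), 0)" using Z linear_0[OF S(1)] by (simp add: T_def real_edge_def)
    have "norm (S (fst Z)) < r" using small(2)[OF T_ball[of Z]] Z TZ by (simp add: norm_Pair)
    from slice_edge(2,3)[OF this] show "H Z \<in> M \<inter> \<Omega>" "slice_parts (T Z) = (H Z, 0)"
      using reg(6) H_\<Omega>1[of Z] Z \<Omega>1(3) assms(4) by (auto simp: H_def TZ)
  qed
  \<comment> \<open>Here \<open>\<rho> (H Z)\<close> lies in the ball of radius \<open>t e\<close> around \<open>t y0\<close>, where \<open>t\<close> is the scale of \<open>Z\<close>.\<close>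
  have H_W: "H Z \<in> W \<inter> \<Omega>1" if Z: "Z \<in> polydisc 6 \<inter> orthant_wedge" for Z
  proof -
    obtain t where t: "t > 0" "norm (S (snd Z) - t *\<^sub>R (0, y0)) \<le> e / 2 * t"
      using S(4)[of "snd Z"] Z by (auto simp: orthant_wedge_def)
    define v where "v = S (snd Z)"
    have nv: "norm v \<le> t * (norm y0 + e / 2)"
    proof -
      have "norm (0 :: real ^ 'n, y0) = norm y0" by (simp add: norm_Pair)
      then have "norm (t *\<^sub>R (0 :: real ^ 'n, y0)) = t * norm y0" using t(1) by (simp only: norm_scaleR abs_of_pos)
      moreover have "norm v \<le> norm (t *\<^sub>R (0 :: real ^ 'n, y0)) + norm (v - t *\<^sub>R (0, y0))"
        by (rule norm_triangle_sub)
      ultimately have "norm v \<le> t * norm y0 + e / 2 * t" using t(2) unfolding v_def by linarith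
      then show ?thesis by (simp add: algebra_simps)
    qed
    have "norm (snd v - t *\<^sub>R y0) \<le> e / 2 * t"
      using t(2) norm_snd_le[of "snd v - t *\<^sub>R y0" "fst v"] by (cases v) (simp add: v_def[symmetric])
    moreover have "norm (graph_defining_function \<phi> (H Z) - snd v) \<le> t * (e / 4)"
    proof -
      have "norm (graph_defining_function \<phi> (H Z) - snd v) \<le> k * norm v"
        using d1(3)[OF small(1)[OF T_ball[of Z]]] Z by (simp add: H_def T_def v_def)
      also have "\<dots> \<le> k * (t * (norm y0 + e / 2))" using nv k by simp
      also have "\<dots> = t * (k * (norm y0 + e / 2))" by simp
      also have "k * (norm y0 + e / 2) \<le> k * (e + norm y0 + 1)" using k e(1) by simp
      also have "k * (e + norm y0 + 1) = e / 4"
      proof -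
        have "e / (4 * a) * a = e / 4" if "a > 0" for a using that by simp
        moreover have "e + norm y0 + 1 > 0" using e(1) norm_ge_zero[of y0] by linarith
        ultimately show ?thesis unfolding k_def by blast
      qed
      finally show ?thesis using t(1) by simp
    qed
    ultimately have "norm (graph_defining_function \<phi> (H Z) - t *\<^sub>R y0) \<le> t * (3 / 4 * e)"
      using norm_triangle_ineq[of "graph_defining_function \<phi> (H Z) - snd v" "snd v - t *\<^sub>R y0"]
      by (simp add: algebra_simps)
    moreover have "graph_defining_function \<phi> (H Z) - t *\<^sub>R y0
        = t *\<^sub>R ((1 / t) *\<^sub>R graph_defining_function \<phi> (H Z) - y0)"
      using t(1) by (simp add: scaleR_diff_right)
    ultimately have "t * norm ((1 / t) *\<^sub>R graph_defining_function \<phi> (H Z) - y0) \<le> t * (3 / 4 * e)"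
      using t(1) by simp
    then have "norm ((1 / t) *\<^sub>R graph_defining_function \<phi> (H Z) - y0) \<le> 3 / 4 * e"
      using t(1) by (simp only: mult_le_cancel_left_pos)
    then have "(1 / t) *\<^sub>R graph_defining_function \<phi> (H Z) \<in> ball y0 e"
      using e(1) by (simp add: dist_norm norm_minus_commute)
    then have "t *\<^sub>R ((1 / t) *\<^sub>R graph_defining_function \<phi> (H Z)) \<in> \<Gamma>"
      using e(2) t(1) \<Gamma>(3) by blast
    then show ?thesis using t(1) H_\<Omega>1[of Z] Z unfolding W1 by simp
  qed

  \<comment> \<open>The continuation of \<open>Im f\<close> from the slice; subtracting \<open>\<i>\<close> times it makes \<open>f\<close> real there.\<close>
  define V where "V = (\<lambda>Z. GC (slice_parts (T Z)))"
  have V_holo: "holo_on Jc ((*) \<i>) V (polydisc 6)"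
    unfolding V_def
  proof (rule holo_on_compose[OF _ GC(2)])
    show "holo_on Jc Jc (\<lambda>Z. slice_parts (T Z)) (polydisc 6)"
      by (rule holo_on_compose[OF T_holo slice_parts_holo T_sub])
    show "(\<lambda>Z. slice_parts (T Z)) ` polydisc 6 \<subseteq> ball 0 rG"
      using small(4) T_ball by blast
  qed
  have V_edge: "V Z = of_real (Im (f_ext (H Z)))" if Z: "Z \<in> polydisc 6 \<inter> real_edge" for Z
  proof -
    have "norm (H Z) < rG"
      using small(4)[OF T_ball[of Z]] H_edge(2)[OF Z] Z by (simp add: norm_Pair)
    moreover have "H Z \<in> M \<inter> \<Omega> \<inter> U" using H_edge(1)[OF Z] H_\<Omega>1[of Z] Z \<Omega>1(3) by blast
    ultimately show ?thesis using GC(3) UG(4) H_edge(2)[OF Z] by (simp add: V_def)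
  qed

  define g where "g = (\<lambda>Z. f_ext (H Z) + (- \<i>) * V Z)"
  have g_cont: "continuous_on (polydisc 6 \<inter> (orthant_wedge \<union> real_edge)) g"
  proof -
    have "continuous_on (polydisc 6 \<inter> (orthant_wedge \<union> real_edge)) (\<lambda>Z. f_ext (H Z))"
    proof (rule continuous_on_compose2[OF assms(8)])
      show "continuous_on (polydisc 6 \<inter> (orthant_wedge \<union> real_edge)) H"
        by (rule continuous_on_subset[OF holo_on_imp_continuous_on[OF H_holo]]) blast
    qed (use H_W H_edge(1) in blast)
    moreover have "continuous_on (polydisc 6 \<inter> (orthant_wedge \<union> real_edge)) V"
      by (rule continuous_on_subset[OF holo_on_imp_continuous_on[OF V_holo]]) blast
    ultimately show ?thesis unfolding g_def by (intro continuous_intros)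
  qed
  have g_holo: "holo_on Jc ((*) \<i>) g (polydisc 6 \<inter> orthant_wedge)"
  proof -
    have "holo_on Jc ((*) \<i>) (\<lambda>Z. f (H Z)) (polydisc 6 \<inter> orthant_wedge)"
      by (rule holo_on_compose[OF holo_on_subset[OF H_holo] f_holo]) (use H_W in auto)
    then have "holo_on Jc ((*) \<i>) (\<lambda>Z. f (H Z) + (- \<i>) * V Z) (polydisc 6 \<inter> orthant_wedge)"
      by (rule holo_on_add_scaled[OF _ holo_on_subset[OF V_holo]]) blast
    then show ?thesis
      by (rule holo_on_cong[OF open_Int[OF open_polydisc open_orthant(1)], rotated])
         (use H_W assms(9) in \<open>auto simp: g_def\<close>)
  qed
  have g_real: "Im (g Z) = 0" if "Z \<in> polydisc 6 \<inter> real_edge" for Z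
    using V_edge[OF that] by (simp add: g_def)
  obtain F1 where F1: "holo_on Jc ((*) \<i>) F1 (polydisc 1)"
    "\<And>Z. Z \<in> polydisc 1 \<inter> orthant_wedge \<Longrightarrow> F1 Z = g Z"
    by (rule edge_of_the_wedge_reflection[OF g_cont g_holo g_real]) (assumption, rule that)

  have sub16: "polydisc 1 \<subseteq> (polydisc 6 :: (('n, 'd) slice_space \<times> ('n, 'd) slice_space) set)"
    by (rule polydisc_mono) simp
  have zero_poly: "0 \<in> (polydisc 1 :: (('n, 'd) slice_space \<times> ('n, 'd) slice_space) set)"
    by (simp add: polydisc_def ccoord_eq)
  \<comment> \<open>The slice map is inverted in real coordinates, where source and target have the same type.\<close>
  have Psi_holo: "holo_on Jc Jc (\<lambda>Z. real_parts (H Z)) (polydisc 1)"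
    by (rule holo_on_compose[OF holo_on_subset[OF H_holo sub16] real_parts_holo subset_UNIV])
  have Psi_der: "((\<lambda>Z. real_parts (H Z)) has_derivative T) (at 0)"
    using diff_chain_at[OF T_der[of 0], of "\<lambda>Z. real_parts (slice Z)" "\<lambda>V. V"]
      real_parts_slice_derivative_0 by (simp add: T_0 H_def o_def)
  obtain A B I where inv: "open A" "A \<subseteq> polydisc 1" "0 \<in> A" "open B"
    "homeomorphism A B (\<lambda>Z. real_parts (H Z)) I" "holo_on Jc Jc I B"
    using holo_inverse_function[OF Psi_holo open_polydisc zero_poly Psi_der T_inj] by metis
  define \<Omega>2 where "\<Omega>2 = real_parts -` B"
  have rp_cont: "continuous_on C real_parts" for C :: "('n, 'd) CC set"
    by (rule holo_on_imp_continuous_on[OF real_parts_holo])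
  have \<Omega>2: "open \<Omega>2" unfolding \<Omega>2_def by (rule open_vimage[OF inv(4) rp_cont])
  have H_A: "H Z \<in> \<Omega>2" "I (real_parts (H Z)) = Z" if "Z \<in> A" for Z
    using inv(5) that by (auto simp: homeomorphism_def \<Omega>2_def)
  have H_I: "I (real_parts Y) \<in> A" "H (I (real_parts Y)) = Y" if "Y \<in> \<Omega>2" for Y
  proof -
    have "real_parts Y \<in> B" using that by (simp add: \<Omega>2_def)
    then have "I (real_parts Y) \<in> A" "real_parts (H (I (real_parts Y))) = real_parts Y"
      using inv(5) by (auto simp: homeomorphism_def)
    then show "I (real_parts Y) \<in> A" "H (I (real_parts Y)) = Y"
      using inj_real_parts by auto
  qed
  have H_0: "H 0 = 0" by (simp add: H_def T_0 slice_0)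

  define F where "F = (\<lambda>Y. F1 (I (real_parts Y)) + \<i> * V (I (real_parts Y)))"
  have F_holo: "holo_on (cscale \<i>) ((*) \<i>) F \<Omega>2"
    unfolding F_def
  proof (rule holo_on_compose[where g = "\<lambda>Z. F1 Z + \<i> * V Z"])
    show "holo_on (cscale \<i>) Jc (\<lambda>Y. I (real_parts Y)) \<Omega>2"
      by (rule holo_on_compose[OF real_parts_holo inv(6)]) (auto simp: \<Omega>2_def)
    show "holo_on Jc ((*) \<i>) (\<lambda>Z. F1 Z + \<i> * V Z) (polydisc 1)"
      by (rule holo_on_add_scaled[OF F1(1) holo_on_subset[OF V_holo sub16]])
    show "(\<lambda>Y. I (real_parts Y)) ` \<Omega>2 \<subseteq> polydisc 1" using H_I(1) inv(2) by blast
  qed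
  have F_eq: "F (H Z) = f (H Z)" "H Z \<in> W" if "Z \<in> A \<inter> orthant_wedge" for Z
  proof -
    have Z: "Z \<in> polydisc 1 \<inter> orthant_wedge" using that inv(2) by blast
    then have HW: "H Z \<in> W" using H_W sub16 by blast
    then show "H Z \<in> W" .
    show "F (H Z) = f (H Z)"
      using F1(2)[OF Z] H_A(2)[of Z] that assms(9) HW by (simp add: F_def g_def)
  qed

  have "0 \<in> \<Omega>2" using H_A(1)[OF inv(3)] by (simp add: H_0)
  then obtain \<Omega>3 where \<Omega>3: "open \<Omega>3" "0 \<in> \<Omega>3" "\<Omega>3 \<subseteq> \<Omega>1 \<inter> \<Omega>2"
    "open {Z \<in> \<Omega>3. graph_defining_function \<phi> Z \<in> \<Gamma>}"
    "connected {Z \<in> \<Omega>3. graph_defining_function \<phi> Z \<in> \<Gamma>}"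
    using wedge_neighbourhood[OF \<Gamma>(1,2), of "\<Omega>1 \<inter> \<Omega>2"] \<Omega>1(1,2) \<Omega>2 by blast
  have W3: "W \<inter> \<Omega>3 = {Z \<in> \<Omega>3. graph_defining_function \<phi> Z \<in> \<Gamma>}"
    using \<Omega>3(3) W1 by blast
  \<comment> \<open>An open set of points of the wedge where the equality is known.\<close>
  define N where "N = \<Omega>3 \<inter> {Y \<in> \<Omega>2. I (real_parts Y) \<in> orthant_wedge}"
  have N_open: "open N"
  proof -
    have "continuous_on \<Omega>2 (\<lambda>Y. I (real_parts Y))"
      by (rule continuous_on_compose2[OF holo_on_imp_continuous_on[OF inv(6)] rp_cont]) (auto simp: \<Omega>2_def)
    then have "open (\<Omega>2 \<inter> (\<lambda>Y. I (real_parts Y)) -` orthant_wedge)"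
      by (rule continuous_open_preimage[OF _ \<Omega>2 open_orthant(1)])
    moreover have "N = \<Omega>3 \<inter> (\<Omega>2 \<inter> (\<lambda>Y. I (real_parts Y)) -` orthant_wedge)"
      by (auto simp: N_def)
    ultimately show ?thesis using \<Omega>3(1) by (simp only: open_Int)
  qed
  have N_sub: "N \<subseteq> W \<inter> \<Omega>3" and N_eq: "\<And>Y. Y \<in> N \<Longrightarrow> F Y = f Y"
  proof -
    have *: "F Y = f Y" "Y \<in> W" if "Y \<in> N" for Y
      using that F_eq[of "I (real_parts Y)"] H_I[of Y] by (auto simp: N_def)
    then show "N \<subseteq> W \<inter> \<Omega>3" "\<And>Y. Y \<in> N \<Longrightarrow> F Y = f Y" by (auto simp: N_def)
  qed
  have N_ne: "N \<noteq> {}"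
  proof -
    have H_cont: "continuous_on A H"
      using holo_on_imp_continuous_on[OF H_holo] inv(2) sub16 continuous_on_subset by blast
    have "open (A \<inter> H -` \<Omega>3)" by (rule continuous_open_preimage[OF H_cont inv(1) \<Omega>3(1)])
    moreover have "0 \<in> A \<inter> H -` \<Omega>3" using inv(3) \<Omega>3(2) by (simp add: H_0)
    ultimately obtain s where s: "s > 0" "ball 0 s \<subseteq> A \<inter> H -` \<Omega>3" using open_contains_ball by blast
    define c where "c = (s / 2) / (norm (One :: ('n, 'd) slice_space) + 1)"
    have n: "norm (One :: ('n, 'd) slice_space) + 1 > 0" by (simp add: add_nonneg_pos)
    define Z where "Z = (0 :: ('n, 'd) slice_space, c *\<^sub>R (One :: ('n, 'd) slice_space))"
    have c: "c > 0" using s n by (simp add: c_def)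
    have "c * (norm (One :: ('n, 'd) slice_space) + 1) = s / 2"
      using n nonzero_divide_eq_eq[of "norm (One :: ('n, 'd) slice_space) + 1" "s / 2" c]
      unfolding c_def by linarith
    moreover have "norm Z \<le> c * norm (One :: ('n, 'd) slice_space)"
      using norm_Pair_le[of "0 :: ('n, 'd) slice_space" "c *\<^sub>R One :: ('n, 'd) slice_space"] c
      by (simp add: Z_def)
    ultimately have "norm Z < s" using c s(1) by (simp add: algebra_simps)
    then have "Z \<in> A" "H Z \<in> \<Omega>3" using s(2) by auto
    moreover have "Z \<in> orthant_wedge" using c by (simp add: Z_def orthant_wedge_def)
    ultimately have "H Z \<in> N" using H_A[of Z] by (simp add: N_def)
    then show ?thesis by blast
  qed
  \<comment> \<open>Connectedness of this part of the wedge spreads the equality from \<open>N\<close>.\<close>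
  have "F Y = f Y" if "Y \<in> W \<inter> \<Omega>3" for Y
  proof (rule CC.holo_identity[of F "W \<inter> \<Omega>3" f N])
    show "holo_on (cscale \<i>) ((*) \<i>) F (W \<inter> \<Omega>3)" by (rule holo_on_subset[OF F_holo]) (use \<Omega>3(3) in blast)
    show "holo_on (cscale \<i>) ((*) \<i>) f (W \<inter> \<Omega>3)" by (rule holo_on_subset[OF f_holo]) (use \<Omega>3(3) in blast)
    show "open (W \<inter> \<Omega>3)" "connected (W \<inter> \<Omega>3)" using \<Omega>3(4,5) W3 by auto
  qed (use N_open N_ne N_sub N_eq that in auto)
  moreover have "holomorphic_CC_on F \<Omega>3"
    unfolding holomorphic_CC_on_iff[OF \<Omega>3(1)] by (rule holo_on_subset[OF F_holo]) (use \<Omega>3(3) in blast)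
  ultimately show ?thesis using \<Omega>3(1,2) by blast
qed

end
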